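(* Let $q\ge 2$ be an even integer, $s\in(0,2)$, and let $P(x,t)=|\Psi(x,t)|^2$ be as in the context. Define the average position $\langle x\rangle(t)=\int_0^\pi x\,P(x,t)\,dx$ and the average velocity $v(t)=\frac{d\langle x\rangle}{dt}(t)$. Then $v$ is continuous, and its graph over any compact interval $[a,b]$ with $a<b$ has box-counting dimension $D_v=\max\{(1+s)/2,\,1\}$.
   Context: For an integer $q\ge2$ and $s\in(0,2)$ define, for $x\in[0,\pi]$ and $t\in\mathbb R$, $$\Psi(x,t)=N\sum_{n=0}^{\infty} q^{n(s-2)}\sin(q^n x)\,e^{-i q^{2n} t},\qquad N=\sqrt{\tfrac{2}{\pi}\big(1-q^{2(s-2)}\big)}.$$ Let $P(x,t)=|\Psi(x,t)|^2$. Box-counting dimension of a bounded planar set: $\lim_{\delta\to0}\ln N(\delta)/\ln(1/\delta)$, where $N(\delta)$ is the number of squares of the $\delta$-grid meeting the set. Upper and lower versions use $\limsup$ and $\liminf$, and the dimension exists when they agree. *)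

theory Defs
  imports "HOL-Analysis.Analysis"
begin

definition normc :: "nat \<Rightarrow> real \<Rightarrow> real" where
  "normc q s = sqrt (2 / pi * (1 - real q powr (2 * (s - 2))))"

definition Psi :: "nat \<Rightarrow> real \<Rightarrow> real \<Rightarrow> real \<Rightarrow> complex" where
  "Psi q s x t = complex_of_real (normc q s) *
     (\<Sum>n. complex_of_real (real q powr (real n * (s - 2)) * sin (real q ^ n * x))
           * exp (- \<i> * complex_of_real (real q ^ (2 * n) * t)))"

definition Pdens :: "nat \<Rightarrow> real \<Rightarrow> real \<Rightarrow> real \<Rightarrow> real" where
  "Pdens q s x t = (cmod (Psi q s x t))\<^sup>2"

definition avgpos :: "nat \<Rightarrow> real \<Rightarrow> real \<Rightarrow> real" where
  "avgpos q s t = integral {0..pi} (\<lambda>x. x * Pdens q s x t)"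

definition avgvel :: "nat \<Rightarrow> real \<Rightarrow> real \<Rightarrow> real" where
  "avgvel q s t = deriv (avgpos q s) t"

definition grid_count :: "real \<Rightarrow> (real \<times> real) set \<Rightarrow> nat" where
  "grid_count d S = card {(i :: int, j :: int). \<exists>(x, y) \<in> S.
      of_int i * d \<le> x \<and> x < of_int (i + 1) * d \<and>
      of_int j * d \<le> y \<and> y < of_int (j + 1) * d}"

definition has_box_dim :: "(real \<times> real) set \<Rightarrow> real \<Rightarrow> bool" where
  "has_box_dim S D \<longleftrightarrow>
     ((\<lambda>d. ln (real (grid_count d S)) / ln (1 / d)) \<longlongrightarrow> D) (at_right 0)"

end

theory Submission
  imports Defs "HOL-Real_Asymp.Real_Asymp"
begin

text \<open>
  For even \<open>q\<close> the integral of \<open>x sin (q\<^sup>m x) sin (q\<^sup>n x)\<close> over \<open>[0, \<pi>]\<close> vanishes unless \<open>m = n\<close>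
  or one of \<open>m, n\<close> is \<open>0\<close>. Hence the mean position is a constant plus a lacunary cosine
  series, and the velocity is a Weierstrass-type series with frequencies \<open>q ^ (2n) - 1\<close> and
  amplitudes of order \<open>q powr (n (s - 3))\<close>. It is Hoelder continuous for every exponent below
  \<open>min 1 ((3 - s) / 2)\<close>, which bounds the number of grid squares from above.

  If \<open>s > 1\<close>, take the second difference of the velocity with step \<open>\<pi> / q ^ (2n)\<close>. The terms of higher
  frequency nearly cancel by periodicity, the \<open>n\<close>-th term contributes about 4 times its
  amplitude wherever its sine is \<open>1\<close> or \<open>-1\<close>, and the terms of lower frequency contribute at most
  \<open>\<pi>\<^sup>2 / 3 < 4\<close> times that amplitude. So the velocity oscillates by a multiple of
  \<open>d powr ((3 - s) / 2)\<close> on every interval of length \<open>d\<close>, and by the intermediate value theorem each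
  grid column then meets the graph in correspondingly many squares.
\<close>

subsection \<open>Box dimension of graphs\<close>

text \<open>Half-open cells partition the plane, so each point lies in exactly one cell, indexed by
  two floors. Counting squares thus becomes the cardinality of an image, the form used in all later
  estimates.\<close>

lemma grid_count_graph:
  assumes "d > 0"
  shows "grid_count d {(t, f t) | t. t \<in> A} = card ((\<lambda>t. (\<lfloor>t / d\<rfloor>, \<lfloor>f t / d\<rfloor>)) ` A)"
proof -
  have cell: "of_int i * d \<le> x \<and> x < of_int (i + 1) * d \<longleftrightarrow> \<lfloor>x / d\<rfloor> = i" for i :: int and x
    using assms by (simp add: floor_eq_iff field_simps)
  have "{(i :: int, j :: int). \<exists>(x, y) \<in> {(t, f t) | t. t \<in> A}.
      of_int i * d \<le> x \<and> x < of_int (i + 1) * d \<and> of_int j * d \<le> y \<and> y < of_int (j + 1) * d}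
     = {(i, j). \<exists>(x, y) \<in> {(t, f t) | t. t \<in> A}. \<lfloor>x / d\<rfloor> = i \<and> \<lfloor>y / d\<rfloor> = j}"
    by (simp only: cell[symmetric] conj_assoc)
  also have "\<dots> = (\<lambda>t. (\<lfloor>t / d\<rfloor>, \<lfloor>f t / d\<rfloor>)) ` A"
    by auto
  finally show ?thesis
    by (simp add: grid_count_def)
qed

text \<open>Finiteness is what makes comparisons of \<open>card\<close> meaningful in the lower
  bounds, since \<open>card\<close> is 0 on infinite sets. It holds because a continuous function on
  a compact interval is bounded.\<close>

lemma finite_graph_cells:
  fixes f :: "real \<Rightarrow> real"
  assumes "d > 0" "continuous_on {a..b} f"
  shows "finite ((\<lambda>t. (\<lfloor>t / d\<rfloor>, \<lfloor>f t / d\<rfloor>)) ` {a..b})"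
proof -
  have "bounded (f ` {a..b})"
    using assms(2) by (intro compact_imp_bounded compact_continuous_image) auto
  then obtain B where B: "\<And>t. t \<in> {a..b} \<Longrightarrow> \<bar>f t\<bar> \<le> B"
    unfolding bounded_iff by (metis image_eqI real_norm_def)
  have "(\<lambda>t. (\<lfloor>t / d\<rfloor>, \<lfloor>f t / d\<rfloor>)) ` {a..b} \<subseteq> {\<lfloor>a / d\<rfloor>..\<lfloor>b / d\<rfloor>} \<times> {\<lfloor>- B / d\<rfloor>..\<lfloor>B / d\<rfloor>}"
  proof (rule image_subsetI)
    fix t assume t: "t \<in> {a..b}"
    have "- B \<le> f t" "f t \<le> B"
      using B[OF t] by auto
    then show "(\<lfloor>t / d\<rfloor>, \<lfloor>f t / d\<rfloor>) \<in> {\<lfloor>a / d\<rfloor>..\<lfloor>b / d\<rfloor>} \<times> {\<lfloor>- B / d\<rfloor>..\<lfloor>B / d\<rfloor>}"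
      using t assms(1) unfolding mem_Times_iff fst_conv snd_conv atLeastAtMost_iff
      by (intro conjI floor_mono divide_right_mono) auto
  qed
  then show ?thesis
    by (rule finite_subset) auto
qed

text \<open>At most \<open>(b - a) / d + 2\<close> columns meet the interval. In each one the
  Hoelder bound keeps all values within \<open>L * d powr \<theta>\<close> of the value at one
  reference point, that is, within \<open>L * d powr (\<theta> - 1)\<close> cells up to
  rounding.\<close>

lemma grid_count_graph_le:
  fixes f :: "real \<Rightarrow> real"
  assumes "0 < d" "d < 1" "a < b" "L \<ge> 0" "0 < \<theta>" "\<theta> \<le> 1"
    and holder: "\<And>x y. \<lbrakk>x \<in> {a..b}; y \<in> {a..b}\<rbrakk> \<Longrightarrow> \<bar>f x - f y\<bar> \<le> L * \<bar>x - y\<bar> powr \<theta>"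
  shows "real (grid_count d {(t, f t) | t. t \<in> {a..b}}) \<le> (b - a + 2) * (2 * L + 3) * d powr (\<theta> - 2)"
proof -
  define I where "I = {\<lfloor>a / d\<rfloor>..\<lfloor>b / d\<rfloor>}"
  \<comment> \<open>The summand 1 pays for rounding: reals at distance at most \<open>M\<close> have
    floors differing by at most \<open>\<lfloor>M\<rfloor> + 1\<close>.\<close>
  define K where "K = \<lfloor>L * d powr (\<theta> - 1)\<rfloor> + 1"
  define p where "p i = (SOME t. t \<in> {a..b} \<and> \<lfloor>t / d\<rfloor> = i)" for i
  have K0: "K \<ge> 1"
    using assms by (simp add: K_def)
  have sub: "(\<lambda>t. (\<lfloor>t / d\<rfloor>, \<lfloor>f t / d\<rfloor>)) ` {a..b}
     \<subseteq> Sigma I (\<lambda>i. {\<lfloor>f (p i) / d\<rfloor> - K..\<lfloor>f (p i) / d\<rfloor> + K})"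
  proof (rule image_subsetI)
    fix t assume t: "t \<in> {a..b}"
    define u where "u = p \<lfloor>t / d\<rfloor>"
    have "u \<in> {a..b} \<and> \<lfloor>u / d\<rfloor> = \<lfloor>t / d\<rfloor>"
      unfolding u_def p_def by (rule someI[of _ t]) (use t in auto)
    then have u: "u \<in> {a..b}" "\<lfloor>u / d\<rfloor> = \<lfloor>t / d\<rfloor>"
      by auto
    have "\<bar>t / d - u / d\<bar> < 1"
      using u(2) by linarith
    then have "\<bar>t - u\<bar> < d"
      using \<open>d > 0\<close> by (simp add: abs_if field_simps split: if_splits)
    then have "\<bar>t - u\<bar> powr \<theta> \<le> d powr \<theta>"
      using \<open>\<theta> > 0\<close> by (intro powr_mono2) auto
    then have "\<bar>f t - f u\<bar> \<le> L * d powr \<theta>"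
      using holder[OF t u(1)] \<open>L \<ge> 0\<close> by (meson mult_left_mono order_trans)
    then have "\<bar>f t - f u\<bar> / d \<le> L * d powr \<theta> / d"
      using \<open>d > 0\<close> by (intro divide_right_mono) auto
    also have "\<dots> = L * d powr (\<theta> - 1)"
      using \<open>d > 0\<close> by (simp add: powr_diff)
    finally have "\<bar>f t / d - f u / d\<bar> \<le> L * d powr (\<theta> - 1)"
      using \<open>d > 0\<close> by (simp add: diff_divide_distrib[symmetric])
    then have "\<lfloor>f t / d\<rfloor> \<in> {\<lfloor>f u / d\<rfloor> - K..\<lfloor>f u / d\<rfloor> + K}"
      unfolding K_def atLeastAtMost_iff by linarith
    moreover have "\<lfloor>t / d\<rfloor> \<in> I"
      using t \<open>d > 0\<close> unfolding I_def atLeastAtMost_iff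
      by (intro conjI floor_mono divide_right_mono) auto
    ultimately show "(\<lfloor>t / d\<rfloor>, \<lfloor>f t / d\<rfloor>) \<in> Sigma I (\<lambda>i. {\<lfloor>f (p i) / d\<rfloor> - K..\<lfloor>f (p i) / d\<rfloor> + K})"
      by (simp add: u_def)
  qed
  have "grid_count d {(t, f t) | t. t \<in> {a..b}}
      \<le> card (Sigma I (\<lambda>i. {\<lfloor>f (p i) / d\<rfloor> - K..\<lfloor>f (p i) / d\<rfloor> + K}))"
    unfolding grid_count_graph[OF \<open>d > 0\<close>] by (intro card_mono sub) (auto simp: I_def)
  also have "\<dots> = card I * nat (2 * K + 1)"
    by (subst card_SigmaI) (auto simp: I_def algebra_simps)
  finally have "real (grid_count d {(t, f t) | t. t \<in> {a..b}}) \<le> real (card I) * real (nat (2 * K + 1))"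
    unfolding of_nat_mult[symmetric] of_nat_le_iff .
  also have "\<dots> \<le> ((b - a + 2) / d) * ((2 * L + 3) * d powr (\<theta> - 1))"
  proof (rule mult_mono)
    have "a / d \<le> b / d"
      using assms by (intro divide_right_mono) auto
    then have "real (card I) \<le> b / d - a / d + 2"
      unfolding I_def by simp linarith
    also have "\<dots> = (b - a) / d + 2"
      by (simp add: diff_divide_distrib)
    also have "\<dots> \<le> (b - a) / d + 2 / d"
      using assms by (intro add_left_mono) (simp add: field_simps)
    finally show "real (card I) \<le> (b - a + 2) / d"
      by (simp add: add_divide_distrib)
    \<comment> \<open>Since \<open>d < 1\<close> and \<open>\<theta> \<le> 1\<close>, the additive
      constant 3 from rounding can be absorbed into a multiple of this power.\<close>
    have "1 \<le> d powr (\<theta> - 1)"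
      using powr_mono'[of "\<theta> - 1" 0 d] assms by auto
    moreover have "real (nat (2 * K + 1)) \<le> 2 * (L * d powr (\<theta> - 1)) + 3"
    proof -
      have "of_int K \<le> L * d powr (\<theta> - 1) + 1"
        unfolding K_def by linarith
      then show ?thesis
        using K0 by simp
    qed
    ultimately show "real (nat (2 * K + 1)) \<le> (2 * L + 3) * d powr (\<theta> - 1)"
      by (simp add: algebra_simps)
  qed (use assms in auto)
  also have "\<dots> = (b - a + 2) * (2 * L + 3) * (d powr (\<theta> - 1) / d)"
    by simp
  also have "d powr (\<theta> - 1) / d = d powr (\<theta> - 2)"
    using \<open>d > 0\<close> powr_diff[of d "\<theta> - 1" 1] by simp
  finally show ?thesis .
qed

text \<open>The columns containing \<open>a\<close> and \<open>b\<close> may stick out of the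
  interval, so the lower bounds use only the columns strictly between them.\<close>

lemma full_column_subset:
  fixes a b d :: real
  assumes "d > 0" "i \<in> {\<lfloor>a / d\<rfloor> + 1..\<lfloor>b / d\<rfloor> - 1}"
  shows "{of_int i * d..<of_int i * d + d} \<subseteq> {a..b}"
proof -
  have "a / d \<le> of_int i" "of_int i + 1 \<le> b / d"
    using assms(2) unfolding atLeastAtMost_iff by linarith+
  then have "a \<le> of_int i * d" "of_int i * d + d \<le> b"
    using assms(1) by (auto simp: field_simps)
  then show ?thesis
    by auto
qed

text \<open>Dropping the boundary columns and rounding cost at most 2 out of
  \<open>(b - a) / d\<close>. This quotient is at least 4, so at least half of it remains.\<close>

lemma card_full_columns_ge:
  fixes a b d :: real
  assumes "d > 0" "4 * d \<le> b - a"
  shows "real (card {\<lfloor>a / d\<rfloor> + 1..\<lfloor>b / d\<rfloor> - 1}) \<ge> (b - a) / 2 / d"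
proof -
  have "b / d - a / d = (b - a) / d"
    by (simp add: diff_divide_distrib)
  moreover have "(b - a) / d \<ge> 4"
    using assms by (simp add: field_simps)
  moreover have "(b - a) / 2 / d = (b - a) / d / 2"
    by simp
  ultimately show ?thesis
    by simp linarith
qed

text \<open>Every full column contains a point of the graph, so projecting the cells to their first
  index already yields enough of them. This gives the lower bound 1 for the dimension.\<close>

lemma grid_count_graph_ge_length:
  fixes f :: "real \<Rightarrow> real"
  assumes "d > 0" "4 * d \<le> b - a" "continuous_on {a..b} f"
  shows "real (grid_count d {(t, f t) | t. t \<in> {a..b}}) \<ge> (b - a) / 2 / d"
proof -
  let ?X = "(\<lambda>t. (\<lfloor>t / d\<rfloor>, \<lfloor>f t / d\<rfloor>)) ` {a..b}"
  let ?I = "{\<lfloor>a / d\<rfloor> + 1..\<lfloor>b / d\<rfloor> - 1}"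
  have "?I \<subseteq> fst ` ?X"
  proof
    fix i assume "i \<in> ?I"
    then have "of_int i * d \<in> {a..b}"
      using full_column_subset[OF assms(1), of i a b] assms(1) by fastforce
    moreover have "\<lfloor>of_int i * d / d\<rfloor> = i"
      using assms(1) by simp
    ultimately show "i \<in> fst ` ?X"
      by force
  qed
  then have "card ?I \<le> card (fst ` ?X)"
    using finite_graph_cells[OF assms(1,3)] by (intro card_mono) auto
  also have "\<dots> \<le> card ?X"
    using finite_graph_cells[OF assms(1,3)] by (rule card_image_le)
  finally show ?thesis
    using card_full_columns_ge[OF assms(1,2)] unfolding grid_count_graph[OF assms(1)] by linarith
qed

text \<open>If the values over a full column differ by at least \<open>c\<close>, the intermediate
  value theorem makes the graph cross all cells between them, at least \<open>c / d\<close> many.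
  Summing over the full columns gives the product.\<close>

lemma grid_count_graph_ge_oscillation:
  fixes f :: "real \<Rightarrow> real"
  assumes "d > 0" "4 * d \<le> b - a" "continuous_on {a..b} f" "c \<ge> 0"
    and osc: "\<And>x. {x..<x + d} \<subseteq> {a..b} \<Longrightarrow> \<exists>u\<in>{x..<x + d}. \<exists>v\<in>{x..<x + d}. \<bar>f u - f v\<bar> \<ge> c"
  shows "real (grid_count d {(t, f t) | t. t \<in> {a..b}}) \<ge> (b - a) / 2 / d * (c / d)"
proof -
  define X where "X = (\<lambda>t. (\<lfloor>t / d\<rfloor>, \<lfloor>f t / d\<rfloor>)) ` {a..b}"
  define I where "I = {\<lfloor>a / d\<rfloor> + 1..\<lfloor>b / d\<rfloor> - 1}"
  have ex: "\<exists>u v. u \<in> {of_int i * d..<of_int i * d + d} \<and> v \<in> {of_int i * d..<of_int i * d + d} \<and> f v - f u \<ge> c"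
    if "i \<in> I" for i :: int
  proof -
    have "\<exists>u\<in>{of_int i * d..<of_int i * d + d}. \<exists>v\<in>{of_int i * d..<of_int i * d + d}. \<bar>f u - f v\<bar> \<ge> c"
      using full_column_subset[OF assms(1)] that unfolding I_def by (intro osc) blast
    then obtain u v where uv: "u \<in> {of_int i * d..<of_int i * d + d}"
        "v \<in> {of_int i * d..<of_int i * d + d}" "\<bar>f u - f v\<bar> \<ge> c"
      by blast
    show ?thesis
    proof (cases "f u \<le> f v")
      case True
      with uv show ?thesis by (intro exI[of _ u] exI[of _ v]) auto
    next
      case False
      with uv show ?thesis by (intro exI[of _ v] exI[of _ u]) auto
    qed
  qed
  then obtain u v where u: "\<And>i. i \<in> I \<Longrightarrow> u i \<in> {of_int i * d..<of_int i * d + d}"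
    and v: "\<And>i. i \<in> I \<Longrightarrow> v i \<in> {of_int i * d..<of_int i * d + d}"
    and uv: "\<And>i. i \<in> I \<Longrightarrow> f (v i) - f (u i) \<ge> c"
    by metis
  define J where "J i = {\<lfloor>f (u i) / d\<rfloor>..\<lfloor>f (v i) / d\<rfloor>}" for i
  have sub: "Sigma I J \<subseteq> X"
  proof
    fix z assume "z \<in> Sigma I J"
    then obtain i j where z: "z = (i, j)" "i \<in> I" "j \<in> J i"
      by auto
    let ?C = "{of_int i * d..<of_int i * d + d}"
    have C: "?C \<subseteq> {a..b}"
      using full_column_subset[OF assms(1)] z(2) unfolding I_def by blast
    \<comment> \<open>The lowest cell contains the graph point over \<open>u i\<close>. Every higher
      cell of \<open>J i\<close> has its bottom edge \<open>of_int j * d\<close> between the two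
      values, and that height is attained over the connected column.\<close>
    obtain w where w: "w \<in> ?C" "\<lfloor>f w / d\<rfloor> = j"
    proof (cases "j = \<lfloor>f (u i) / d\<rfloor>")
      case True
      then show ?thesis using that u[OF z(2)] by blast
    next
      case False
      have "f (u i) / d \<le> of_int j" "of_int j \<le> f (v i) / d"
        using z(3) False unfolding J_def atLeastAtMost_iff by linarith+
      then have j: "f (u i) \<le> of_int j * d" "of_int j * d \<le> f (v i)"
        using assms(1) by (auto simp: field_simps)
      have "connected (f ` ?C)"
        using assms(3) C by (intro connected_continuous_image) (auto intro: continuous_on_subset)
      then have "of_int j * d \<in> f ` ?C"
        by (rule connectedD_interval[OF _ imageI[OF u[OF z(2)]] imageI[OF v[OF z(2)]] j])
      then obtain w where "w \<in> ?C" "f w = of_int j * d"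
        by auto
      then show ?thesis
        using that assms(1) by simp
    qed
    have "of_int i * d \<le> w" "w < (of_int i + 1) * d"
      using w(1) by (auto simp: algebra_simps)
    then have "\<lfloor>w / d\<rfloor> = i"
      using assms(1) by (simp add: floor_eq_iff field_simps)
    then show "z \<in> X"
      using w C unfolding X_def z(1) by (intro image_eqI[of _ _ w]) auto
  qed
  have card_J: "real (card (J i)) \<ge> c / d" if "i \<in> I" for i
  proof -
    have "c / d \<le> (f (v i) - f (u i)) / d"
      using uv[OF that] assms(1) by (intro divide_right_mono) auto
    also have "\<dots> = f (v i) / d - f (u i) / d"
      by (simp add: diff_divide_distrib)
    finally have "c / d \<le> f (v i) / d - f (u i) / d" .
    then show ?thesis
      unfolding J_def by simp linarith
  qed
  have "(b - a) / 2 / d * (c / d) \<le> real (card I) * (c / d)"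
    using card_full_columns_ge[OF assms(1,2)] assms(1,4) unfolding I_def
    by (intro mult_right_mono) auto
  also have "\<dots> = (\<Sum>i\<in>I. c / d)"
    by simp
  also have "\<dots> \<le> (\<Sum>i\<in>I. real (card (J i)))"
    by (intro sum_mono card_J)
  also have "\<dots> = real (card (Sigma I J))"
    by (subst card_SigmaI) (auto simp: I_def J_def)
  also have "\<dots> \<le> real (card X)"
    unfolding of_nat_le_iff X_def
    by (intro card_mono finite_graph_cells[OF assms(1,3)] sub[unfolded X_def])
  finally show ?thesis
    unfolding grid_count_graph[OF assms(1)] X_def .
qed

section \<open>From power bounds on the count to limits of logarithmic quotients\<close>

lemma log_count_tendsto:
  fixes c D :: real
  shows "((\<lambda>d. (ln c + D * ln (1 / d)) / ln (1 / d)) \<longlongrightarrow> D) (at_right 0)"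
  by real_asymp

lemma log_count_eventually_less:
  fixes N :: "real \<Rightarrow> nat"
  assumes "C > 0" "eventually (\<lambda>d. real (N d) \<le> C * d powr (- D)) (at_right 0)" "D < y" "0 < y"
  shows "eventually (\<lambda>d. ln (real (N d)) / ln (1 / d) < y) (at_right 0)"
proof -
  have "eventually (\<lambda>d. (ln C + D * ln (1 / d)) / ln (1 / d) < y) (at_right 0)"
    using log_count_tendsto assms(3) by (rule order_tendstoD)
  moreover have "eventually (\<lambda>d::real. 0 < d \<and> d < 1) (at_right 0)"
    using eventually_at_right_real[of 0 1] by simp
  ultimately show ?thesis
    using assms(2)
  proof eventually_elim
    case (elim d)
    have pos: "ln (1 / d) > 0"
      using elim by (simp add: ln_div)
    show ?case
    \<comment> \<open>As \<open>ln 0 = 0\<close>, a zero count makes the quotient 0, which is below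
      \<open>y\<close> by the assumption \<open>0 < y\<close>.\<close>
    proof (cases "N d = 0")
      case False
      then have "ln (real (N d)) \<le> ln (C * d powr (- D))"
        using elim assms(1) by simp
      also have "\<dots> = ln C + D * ln (1 / d)"
        using elim assms(1) by (simp add: ln_mult ln_powr ln_div)
      finally have "ln (real (N d)) / ln (1 / d) \<le> (ln C + D * ln (1 / d)) / ln (1 / d)"
        using pos by (intro divide_right_mono) auto
      then show ?thesis
        using elim by linarith
    qed (use assms(4) in auto)
  qed
qed

lemma log_count_eventually_greater:
  fixes N :: "real \<Rightarrow> nat"
  assumes "c > 0" "eventually (\<lambda>d. real (N d) \<ge> c * d powr (- D)) (at_right 0)" "y < D"
  shows "eventually (\<lambda>d. y < ln (real (N d)) / ln (1 / d)) (at_right 0)"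
proof -
  have "eventually (\<lambda>d. y < (ln c + D * ln (1 / d)) / ln (1 / d)) (at_right 0)"
    using log_count_tendsto assms(3) by (rule order_tendstoD)
  moreover have "eventually (\<lambda>d::real. 0 < d \<and> d < 1) (at_right 0)"
    using eventually_at_right_real[of 0 1] by simp
  ultimately show ?thesis
    using assms(2)
  proof eventually_elim
    case (elim d)
    have pos: "ln (1 / d) > 0"
      using elim by (simp add: ln_div)
    have "0 < c * d powr (- D)"
      using elim assms(1) by simp
    have "ln c + D * ln (1 / d) = ln (c * d powr (- D))"
      using elim assms(1) by (simp add: ln_mult ln_powr ln_div)
    also have "\<dots> \<le> ln (real (N d))"
      using elim \<open>0 < c * d powr (- D)\<close> by (intro ln_mono) auto
    finally have "(ln c + D * ln (1 / d)) / ln (1 / d) \<le> ln (real (N d)) / ln (1 / d)"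
      using pos by (intro divide_right_mono) auto
    then show ?case
      using elim by linarith
  qed
qed

text \<open>The limit tolerates arbitrarily small losses in the exponent, so the upper bound needs
  Hoelder continuity only for exponents below \<open>min 1 h\<close>. The matching lower bound comes
  from oscillation of order \<open>d powr h\<close> if \<open>h < 1\<close>, and from the length of
  the interval otherwise.\<close>

lemma has_box_dim_graph:
  fixes f :: "real \<Rightarrow> real"
  assumes "a < b" "continuous_on {a..b} f" "0 < h"
    and holder: "\<And>\<theta>. \<lbrakk>0 < \<theta>; \<theta> < 1; \<theta> < h\<rbrakk> \<Longrightarrow>
      \<exists>L. \<forall>x\<in>{a..b}. \<forall>y\<in>{a..b}. \<bar>f x - f y\<bar> \<le> L * \<bar>x - y\<bar> powr \<theta>"
    and osc: "h < 1 \<Longrightarrow> \<exists>c>0. eventually (\<lambda>d. \<forall>x. {x..<x + d} \<subseteq> {a..b} \<longrightarrow>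
      (\<exists>u\<in>{x..<x + d}. \<exists>v\<in>{x..<x + d}. \<bar>f u - f v\<bar> \<ge> c * d powr h)) (at_right 0)"
  shows "has_box_dim {(t, f t) | t. t \<in> {a..b}} (max (2 - h) 1)"
  unfolding has_box_dim_def
proof (rule order_tendstoI)
  have small: "eventually (\<lambda>d::real. 0 < d \<and> d < 1 \<and> 4 * d \<le> b - a) (at_right 0)"
    using eventually_at_right_real[of 0 "min 1 ((b - a) / 4)"] assms(1)
    by (auto elim!: eventually_mono)
  fix y assume y: "y < max (2 - h) 1"
  show "eventually (\<lambda>d. y < ln (real (grid_count d {(t, f t) | t. t \<in> {a..b}})) / ln (1 / d)) (at_right 0)"
  proof (cases "h < 1")
    case True
    from osc[OF this] obtain c where c: "c > 0"
      and ev: "eventually (\<lambda>d. \<forall>x. {x..<x + d} \<subseteq> {a..b} \<longrightarrow>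
      (\<exists>u\<in>{x..<x + d}. \<exists>v\<in>{x..<x + d}. \<bar>f u - f v\<bar> \<ge> c * d powr h)) (at_right 0)"
      by blast
    show ?thesis
    proof (rule log_count_eventually_greater[where D = "2 - h" and c = "(b - a) / 2 * c"])
      show "eventually (\<lambda>d. real (grid_count d {(t, f t) | t. t \<in> {a..b}})
          \<ge> (b - a) / 2 * c * d powr (- (2 - h))) (at_right 0)"
        using small ev
      proof eventually_elim
        case (elim d)
        have "d powr (- (2 - h)) = d powr h / (d * d)"
          using elim powr_diff[of d h 2] by (simp add: power2_eq_square)
        then have "(b - a) / 2 * c * d powr (- (2 - h)) = (b - a) / 2 / d * (c * d powr h / d)"
          by simp
        also have "\<dots> \<le> real (grid_count d {(t, f t) | t. t \<in> {a..b}})"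
          using elim assms(2) c by (intro grid_count_graph_ge_oscillation) auto
        finally show ?case .
      qed
    qed (use assms(1) c y True in auto)
  next
    case False
    show ?thesis
    proof (rule log_count_eventually_greater[where D = 1 and c = "(b - a) / 2"])
      show "eventually (\<lambda>d. real (grid_count d {(t, f t) | t. t \<in> {a..b}})
          \<ge> (b - a) / 2 * d powr (- 1)) (at_right 0)"
        using small
      proof eventually_elim
        case (elim d)
        then have "(b - a) / 2 * d powr (- 1) = (b - a) / 2 / d"
          by (simp add: powr_minus_divide)
        also have "\<dots> \<le> real (grid_count d {(t, f t) | t. t \<in> {a..b}})"
          using elim assms(2) by (intro grid_count_graph_ge_length) auto
        finally show ?case .
      qed
    qed (use assms(1) y False in auto)
  qed
next
  have small: "eventually (\<lambda>d::real. 0 < d \<and> d < 1) (at_right 0)"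
    using eventually_at_right_real[of 0 1] by simp
  fix y assume y: "y > max (2 - h) 1"
  \<comment> \<open>This leaves room for an admissible Hoelder exponent \<open>\<theta>\<close> with
    \<open>2 - \<theta> < y\<close>.\<close>
  have "max 0 (2 - y) < min 1 h"
    using y assms(3) by auto
  then obtain \<theta> where \<theta>: "max 0 (2 - y) < \<theta>" "\<theta> < min 1 h"
    using dense by blast
  then obtain L' where L': "\<And>x y. \<lbrakk>x \<in> {a..b}; y \<in> {a..b}\<rbrakk> \<Longrightarrow> \<bar>f x - f y\<bar> \<le> L' * \<bar>x - y\<bar> powr \<theta>"
    using holder[of \<theta>] by (metis max.strict_boundedE min.strict_boundedE)
  \<comment> \<open>The Hoelder hypothesis does not fix the sign of its constant, while the counting
    bound asks for a nonnegative one.\<close>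
  define L where "L = max L' 0"
  have L: "\<bar>f x - f y\<bar> \<le> L * \<bar>x - y\<bar> powr \<theta>" if "x \<in> {a..b}" "y \<in> {a..b}" for x y
  proof -
    have "L' * \<bar>x - y\<bar> powr \<theta> \<le> L * \<bar>x - y\<bar> powr \<theta>"
      unfolding L_def by (intro mult_right_mono) auto
    then show ?thesis
      using L'[OF that] by linarith
  qed
  show "eventually (\<lambda>d. ln (real (grid_count d {(t, f t) | t. t \<in> {a..b}})) / ln (1 / d) < y) (at_right 0)"
  proof (rule log_count_eventually_less[where D = "2 - \<theta>" and C = "(b - a + 2) * (2 * L + 3)"])
    show "eventually (\<lambda>d. real (grid_count d {(t, f t) | t. t \<in> {a..b}})
        \<le> (b - a + 2) * (2 * L + 3) * d powr (- (2 - \<theta>))) (at_right 0)"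
      using small
    proof eventually_elim
      case (elim d)
      then show ?case
        using grid_count_graph_le[of d a b L \<theta> f] L \<theta> assms(1) by (auto simp: L_def)
    qed
    show "0 < (b - a + 2) * (2 * L + 3)"
      using assms(1) by (intro mult_pos_pos) (auto simp: L_def)
  qed (use y \<theta> in auto)
qed

subsection \<open>The velocity series\<close>

lemma abs_sin_diff_le_powr:
  fixes x y :: real
  assumes "0 < \<theta>" "\<theta> \<le> 1"
  shows "\<bar>sin x - sin y\<bar> \<le> 2 * \<bar>x - y\<bar> powr \<theta>"
proof (cases "\<bar>x - y\<bar> \<le> 1")
  case True
  have "sin x - sin y = 2 * sin ((x - y) / 2) * cos ((x + y) / 2)"
    by (simp add: sin_diff_sin)
  then have "\<bar>sin x - sin y\<bar> = 2 * (\<bar>sin ((x - y) / 2)\<bar> * \<bar>cos ((x + y) / 2)\<bar>)"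
    by (simp add: abs_mult)
  also have "\<dots> \<le> 2 * (\<bar>(x - y) / 2\<bar> * 1)"
    by (intro mult_left_mono mult_mono abs_sin_x_le_abs_x) auto
  also have "\<dots> = \<bar>x - y\<bar> powr 1"
    by simp
  also have "\<dots> \<le> \<bar>x - y\<bar> powr \<theta>"
    using True assms by (intro powr_mono') auto
  also have "\<dots> \<le> 2 * \<bar>x - y\<bar> powr \<theta>"
    by simp
  finally show ?thesis .
next
  case False
  have "\<bar>sin x\<bar> \<le> 1" "\<bar>sin y\<bar> \<le> 1"
    by auto
  moreover have "1 \<le> \<bar>x - y\<bar> powr \<theta>"
    using False assms by (intro ge_one_powr_ge_zero) auto
  ultimately show ?thesis
    by linarith
qed

text \<open>Each sine is an eigenfunction of the symmetric second difference. The factor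
  \<open>(sin (w * h / 2))\<^sup>2\<close> shows which frequencies a step \<open>h\<close>
  suppresses and which it amplifies.\<close>

lemma sin_second_difference:
  fixes w t h :: real
  shows "sin (w * (t + h)) - 2 * sin (w * t) + sin (w * (t - h)) = - 4 * (sin (w * h / 2))\<^sup>2 * sin (w * t)"
proof -
  have "cos (w * h) = 1 - 2 * (sin (w * h / 2))\<^sup>2"
    using cos_double_sin[of "w * h / 2"] by simp
  moreover have "sin (w * (t + h)) - 2 * sin (w * t) + sin (w * (t - h)) = 2 * sin (w * t) * (cos (w * h) - 1)"
    by (simp add: distrib_left right_diff_distrib sin_add sin_diff)
  ultimately show ?thesis
    by simp
qed

lemma sin_squared_le:
  fixes x :: real
  shows "(sin x)\<^sup>2 \<le> x\<^sup>2"
  using abs_sin_x_le_abs_x[of x] by (simp add: abs_le_square_iff)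

text \<open>The zeros of the cosine of \<open>w * t\<close> are spaced by \<open>pi / w\<close>, so
  every closed interval of that length contains one.\<close>

lemma ex_abs_sin_eq_1:
  fixes w x :: real
  assumes "w > 0"
  shows "\<exists>t\<in>{x..x + pi / w}. \<bar>sin (w * t)\<bar> = 1"
proof -
  define j where "j = \<lceil>(w * x - pi / 2) / pi\<rceil>"
  define t where "t = (pi / 2 + of_int j * pi) / w"
  have "(w * x - pi / 2) / pi \<le> of_int j" "of_int j \<le> (w * x - pi / 2) / pi + 1"
    unfolding j_def by linarith+
  then have "w * x \<le> pi / 2 + of_int j * pi" "pi / 2 + of_int j * pi \<le> w * x + pi"
    by (simp_all add: field_simps)
  then have "t \<in> {x..x + pi / w}"
    using assms unfolding t_def atLeastAtMost_iff
    by (auto simp: pos_le_divide_eq pos_divide_le_eq distrib_right mult.commute[of w])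
  moreover have "w * t = pi / 2 + of_int j * pi"
    using assms by (simp add: t_def)
  then have "cos (w * t) = 0"
    unfolding cos_zero_iff_int2 by (metis add.commute)
  then have "(sin (w * t))\<^sup>2 = 1"
    using sin_cos_squared_add[of "w * t"] by simp
  then have "\<bar>sin (w * t)\<bar> = 1"
    by (simp add: power2_eq_1_iff) auto
  ultimately show ?thesis
    by blast
qed

text \<open>A geometric sum is at most the next term divided by \<open>r - 1\<close>, and
  \<open>r - 1 \<ge> 3\<close>.\<close>

lemma sum_powers_le_third:
  fixes r :: real
  assumes "r \<ge> 4"
  shows "(\<Sum>k<n. r ^ Suc k) \<le> r ^ Suc n / 3"
proof (induction n)
  case (Suc n)
  have "(\<Sum>k<Suc n. r ^ Suc k) \<le> r ^ Suc n * (4 / 3)"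
    using Suc by simp
  also have "\<dots> \<le> r ^ Suc n * (r / 3)"
    using assms by (intro mult_left_mono) auto
  finally show ?case
    by (simp add: mult_ac)
qed (use assms in auto)

text \<open>Leaves a margin of 7/10 in \<open>4 - pi\<^sup>2 / 3\<close>, the constant by which a
  single term of the series beats all lower ones.\<close>

lemma pi_squared_third_le: "pi\<^sup>2 / 3 \<le> (33 / 10 :: real)"
proof -
  have "pi \<le> (3142 / 1000 :: real)"
    using pi_approx(2) by simp
  then have "pi\<^sup>2 \<le> (3142 / 1000 :: real)\<^sup>2"
    by (intro power_mono) auto
  then show ?thesis
    by (simp add: power2_eq_square)
qed

section \<open>Frequencies, amplitudes and Hoelder continuity\<close>

locale box_eigenstate_sum =
  fixes q :: nat and s :: real
  assumes even_q: "even q" and q_ge_2: "q \<ge> 2" and s_pos: "0 < s" and s_less_2: "s < 2"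
begin

text \<open>The beat frequency between level \<open>Suc k\<close> and the ground level 0. The shift
  by one skips level 0, whose frequency would vanish.\<close>

definition freq :: "nat \<Rightarrow> real" where
  "freq k = real q ^ (2 * Suc k) - 1"

text \<open>The amplitude of the beat in the velocity, up to the common factor
  \<open>8 * (normc q s)\<^sup>2\<close> that appears in \<open>avgvel_eq\<close>.\<close>

definition amp :: "nat \<Rightarrow> real" where
  "amp k = real q powr (real (Suc k) * (s - 1)) / freq k"

definition vel :: "real \<Rightarrow> real" where
  "vel t = (\<Sum>k. amp k * sin (freq k * t))"

lemma q_power_ge_4: "real q ^ (2 * Suc k) \<ge> 4"
proof -
  have "(2::real) ^ 2 \<le> 2 ^ (2 * Suc k)"
    by (intro power_increasing) auto
  also have "\<dots> \<le> real q ^ (2 * Suc k)"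
    using q_ge_2 by (intro power_mono) auto
  finally show ?thesis
    by simp
qed

text \<open>Subtracting 1 from a power that is at least 4 costs at most a quarter of it. Hence
  \<open>amp k\<close> is comparable to \<open>real q powr (real (Suc k) * (s - 3))\<close>.\<close>

lemma freq_bounds: "freq k \<ge> 3 / 4 * real q ^ (2 * Suc k)" "freq k \<le> real q ^ (2 * Suc k)" "freq k \<ge> 3"
  using q_power_ge_4[of k] unfolding freq_def by linarith+

lemma freq_pos: "freq k > 0"
  using freq_bounds(3)[of k] by linarith

lemma q_power_eq_powr: "real q ^ (2 * Suc k) = real q powr (2 * real (Suc k))"
  using q_ge_2 by (subst powr_realpow[symmetric]) auto

lemma amp_pos: "amp k > 0"
  using freq_pos[of k] q_ge_2 by (simp add: amp_def)

lemma amp_ge: "amp k \<ge> real q powr (real (Suc k) * (s - 3))"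
proof -
  have "real q powr (real (Suc k) * (s - 3)) = real q powr (real (Suc k) * (s - 1)) / real q ^ (2 * Suc k)"
    unfolding q_power_eq_powr powr_diff[symmetric] by (simp add: algebra_simps)
  also have "\<dots> \<le> amp k"
    unfolding amp_def using freq_bounds[of k] freq_pos[of k] by (intro divide_left_mono) auto
  finally show ?thesis .
qed

lemma amp_le: "amp k \<le> 4 / 3 * real q powr (real (Suc k) * (s - 3))"
proof -
  have "amp k \<le> real q powr (real (Suc k) * (s - 1)) / (3 / 4 * real q ^ (2 * Suc k))"
    unfolding amp_def using freq_bounds[of k] freq_pos[of k] q_ge_2 by (intro divide_left_mono) auto
  also have "\<dots> = 4 / 3 * (real q powr (real (Suc k) * (s - 1)) / real q ^ (2 * Suc k))"
    by simp
  also have "\<dots> = 4 / 3 * real q powr (real (Suc k) * (s - 3))"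
    unfolding q_power_eq_powr powr_diff[symmetric] by (simp add: algebra_simps)
  finally show ?thesis .
qed

text \<open>The terms are dominated by a geometric series of ratio
  \<open>real q powr (s - 3 + 2 * \<theta>)\<close>, which is below 1 exactly for
  \<open>\<theta> < (3 - s) / 2\<close>. This is the source of the critical Hoelder
  exponent.\<close>

lemma summable_amp_freq:
  assumes "\<theta> \<ge> 0" "\<theta> < (3 - s) / 2"
  shows "summable (\<lambda>k. amp k * freq k powr \<theta>)"
proof (rule summable_comparison_test')
  define r where "r = real q powr (s - 3 + 2 * \<theta>)"
  have "r < 1"
    using assms q_ge_2 unfolding r_def by (intro powr_less_one) auto
  moreover have "r > 0"
    using q_ge_2 by (simp add: r_def)
  ultimately show "summable (\<lambda>k. 4 / 3 * r * r ^ k)"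
    by (intro summable_mult summable_geometric) auto
  fix k :: nat
  have "amp k * freq k powr \<theta>
     \<le> 4 / 3 * real q powr (real (Suc k) * (s - 3)) * (real q ^ (2 * Suc k)) powr \<theta>"
    using assms amp_le[of k] amp_pos[of k] freq_bounds[of k] freq_pos[of k]
    by (intro mult_mono powr_mono2) auto
  also have "\<dots> = 4 / 3 * (real q powr (real (Suc k) * (s - 3) + 2 * real (Suc k) * \<theta>))"
    unfolding q_power_eq_powr powr_powr powr_add by simp
  also have "real (Suc k) * (s - 3) + 2 * real (Suc k) * \<theta> = (s - 3 + 2 * \<theta>) * real (Suc k)"
    by (simp add: algebra_simps)
  also have "real q powr \<dots> = r * r ^ k"
    unfolding powr_powr[symmetric] r_def[symmetric] using \<open>r > 0\<close> by (subst powr_realpow) auto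
  finally show "norm (amp k * freq k powr \<theta>) \<le> 4 / 3 * r * r ^ k"
    using amp_pos[of k] by simp
qed

lemma summable_amp: "summable amp"
proof -
  have "amp k * freq k powr 0 = amp k" for k
    using freq_pos[of k] by simp
  then have "(\<lambda>k. amp k * freq k powr 0) = amp"
    by (intro ext)
  then show ?thesis
    using summable_amp_freq[of 0] s_less_2 by auto
qed

lemma summable_amp_mult:
  assumes "\<And>k. \<bar>g k\<bar> \<le> 1"
  shows "summable (\<lambda>k. amp k * g k)"
proof (rule summable_comparison_test'[OF summable_amp])
  fix k
  show "norm (amp k * g k) \<le> amp k"
    using assms[of k] amp_pos[of k] by (simp add: abs_mult)
qed

lemma summable_vel: "summable (\<lambda>k. amp k * sin (freq k * t))"
  by (rule summable_amp_mult) auto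

text \<open>Each term is Hoelder continuous with constant
  \<open>2 * amp k * freq k powr \<theta>\<close>, and these constants are summable.\<close>

lemma vel_holder:
  assumes "0 < \<theta>" "\<theta> < 1" "\<theta> < (3 - s) / 2"
  shows "\<bar>vel x - vel y\<bar> \<le> 2 * (\<Sum>k. amp k * freq k powr \<theta>) * \<bar>x - y\<bar> powr \<theta>"
proof -
  have sm: "summable (\<lambda>k. amp k * freq k powr \<theta>)"
    using assms by (intro summable_amp_freq) auto
  have bound: "norm (amp k * sin (freq k * x) - amp k * sin (freq k * y))
      \<le> 2 * (amp k * freq k powr \<theta>) * \<bar>x - y\<bar> powr \<theta>" for k
  proof -
    have "norm (amp k * sin (freq k * x) - amp k * sin (freq k * y))
        = amp k * \<bar>sin (freq k * x) - sin (freq k * y)\<bar>"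
      using amp_pos[of k] by (simp add: right_diff_distrib[symmetric] abs_mult)
    also have "\<dots> \<le> amp k * (2 * \<bar>freq k * x - freq k * y\<bar> powr \<theta>)"
      using assms amp_pos[of k] by (intro mult_left_mono abs_sin_diff_le_powr) auto
    also have "\<bar>freq k * x - freq k * y\<bar> = freq k * \<bar>x - y\<bar>"
      using freq_pos[of k] by (simp add: right_diff_distrib[symmetric] abs_mult)
    also have "\<dots> powr \<theta> = freq k powr \<theta> * \<bar>x - y\<bar> powr \<theta>"
      using freq_pos[of k] by (simp add: powr_mult)
    finally show ?thesis
      by (simp add: mult_ac)
  qed
  have "vel x - vel y = (\<Sum>k. amp k * sin (freq k * x) - amp k * sin (freq k * y))"
    unfolding vel_def by (intro suminf_diff summable_vel)
  then have "\<bar>vel x - vel y\<bar> = norm (\<Sum>k. amp k * sin (freq k * x) - amp k * sin (freq k * y))"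
    by simp
  also have "\<dots> \<le> (\<Sum>k. 2 * (amp k * freq k powr \<theta>) * \<bar>x - y\<bar> powr \<theta>)"
    using sm by (intro norm_suminf_le bound summable_mult2 summable_mult)
  also have "\<dots> = 2 * (\<Sum>k. amp k * freq k powr \<theta>) * \<bar>x - y\<bar> powr \<theta>"
    using sm by (simp add: suminf_mult suminf_mult2[symmetric] summable_mult)
  finally show ?thesis .
qed

section \<open>Second differences and oscillation from below\<close>

lemma vel_second_difference:
  "vel (t + h) - 2 * vel t + vel (t - h) = - 4 * (\<Sum>k. amp k * ((sin (freq k * h / 2))\<^sup>2 * sin (freq k * t)))"
proof -
  have "(\<lambda>k. amp k * sin (freq k * (t + h)) - 2 * (amp k * sin (freq k * t)) + amp k * sin (freq k * (t - h)))
      sums (vel (t + h) - 2 * vel t + vel (t - h))"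
    unfolding vel_def by (intro sums_add sums_diff sums_mult summable_sums summable_vel)
  also have "(\<lambda>k. amp k * sin (freq k * (t + h)) - 2 * (amp k * sin (freq k * t)) + amp k * sin (freq k * (t - h)))
      = (\<lambda>k. - 4 * (amp k * ((sin (freq k * h / 2))\<^sup>2 * sin (freq k * t))))"
  proof
    fix k
    have "amp k * sin (freq k * (t + h)) - 2 * (amp k * sin (freq k * t)) + amp k * sin (freq k * (t - h))
      = amp k * (sin (freq k * (t + h)) - 2 * sin (freq k * t) + sin (freq k * (t - h)))"
      by (simp add: algebra_simps)
    then show "amp k * sin (freq k * (t + h)) - 2 * (amp k * sin (freq k * t)) + amp k * sin (freq k * (t - h))
      = - 4 * (amp k * ((sin (freq k * h / 2))\<^sup>2 * sin (freq k * t)))"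
      unfolding sin_second_difference by simp
  qed
  finally have "vel (t + h) - 2 * vel t + vel (t - h)
      = (\<Sum>k. - 4 * (amp k * ((sin (freq k * h / 2))\<^sup>2 * sin (freq k * t))))"
    by (simp add: sums_iff)
  also have "\<dots> = - 4 * (\<Sum>k. amp k * ((sin (freq k * h / 2))\<^sup>2 * sin (freq k * t)))"
  proof (rule suminf_mult, rule summable_amp_mult)
    fix k
    have "\<bar>(sin (freq k * h / 2))\<^sup>2\<bar> \<le> 1"
      by (simp add: abs_square_le_1)
    then show "\<bar>(sin (freq k * h / 2))\<^sup>2 * sin (freq k * t)\<bar> \<le> 1"
      unfolding abs_mult by (intro mult_le_one) auto
  qed
  finally show ?thesis .
qed

text \<open>Half a period of the frequency \<open>real q ^ (2 * Suc n)\<close>, so that the factor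
  \<open>(sin (freq n * step n / 2))\<^sup>2\<close> is nearly 1.\<close>

definition step :: "nat \<Rightarrow> real" where
  "step n = pi / real q ^ (2 * Suc n)"

lemma step_pos: "step n > 0"
  using q_ge_2 by (simp add: step_def)

text \<open>As \<open>q\<close> is even, \<open>step n\<close> is a multiple of the period of
  \<open>exp (\<i> * q ^ (2 * j) * t)\<close> for every \<open>j > Suc n\<close>.\<close>

lemma sin_high_freq:
  assumes "n < k"
  shows "(sin (freq k * step n / 2))\<^sup>2 = (sin (step n / 2))\<^sup>2"
proof -
  obtain l where l: "k = Suc (n + l)"
    using assms less_iff_Suc_add by auto
  obtain p where p: "q = 2 * p"
    using even_q by blast
  define N where "N = p\<^sup>2 * q ^ (2 * l)"
  have "real q ^ (2 * Suc k) = real q ^ (2 * Suc n) * real q ^ 2 * real q ^ (2 * l)"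
    by (simp add: l power_add[symmetric])
  then have "real q ^ (2 * Suc k) * step n = pi * (real q ^ 2 * real q ^ (2 * l))"
    using q_ge_2 unfolding step_def by simp
  \<comment> \<open>Evenness of \<open>q\<close> enters here: the factor 4 in
    \<open>real q ^ 2\<close> turns half the phase into a multiple of \<open>2 * pi\<close>. Only
    the 1 subtracted in \<open>freq\<close> then leaves a trace, namely
    \<open>step n / 2\<close>.\<close>
  also have "real q ^ 2 * real q ^ (2 * l) = 4 * real N"
    unfolding N_def p by (simp add: power_mult_distrib)
  finally have "real q ^ (2 * Suc k) * step n / 2 = 2 * pi * real N"
    by simp
  then have "freq k * step n / 2 = 2 * pi * real N - step n / 2"
    by (simp add: freq_def left_diff_distrib diff_divide_distrib)
  also have "sin \<dots> = - sin (step n / 2)"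
    using sin_2npi[of N] cos_2npi[of N] by (simp add: sin_diff mult_ac)
  finally show ?thesis
    by simp
qed

lemma sin_own_freq: "(sin (freq n * step n / 2))\<^sup>2 = (cos (step n / 2))\<^sup>2"
proof -
  have "freq n * step n / 2 = pi / 2 - step n / 2"
    using q_ge_2 by (simp add: freq_def step_def field_simps)
  then have "sin (freq n * step n / 2) = cos (step n / 2)"
    by (simp only: cos_sin_eq of_real_eq_id id_apply)
  then show ?thesis
    by simp
qed

text \<open>Bounding the sine by its argument leaves terms that grow geometrically with ratio
  \<open>real q powr (s + 1)\<close>, and \<open>s > 1\<close> makes this ratio at least 4. The
  constant is \<open>pi\<^sup>2 / 4\<close> from the squared half step times 1/3 from the geometric
  sum.\<close>

lemma low_freq_sum_le:
  assumes "s > 1"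
  shows "(\<Sum>k<n. amp k * (sin (freq k * step n / 2))\<^sup>2) \<le> pi\<^sup>2 / 12 * real q powr (real (Suc n) * (s - 3))"
proof -
  define r where "r = real q powr (s + 1)"
  have r: "r ^ Suc k = real q powr (real (Suc k) * (s + 1))" for k
    using q_ge_2 unfolding r_def by (simp add: powr_powr powr_realpow[symmetric] mult.commute del: power_Suc)
  have "4 = 2 powr (2::real)"
    by simp
  also have "\<dots> \<le> real q powr 2"
    using q_ge_2 by (intro powr_mono2) auto
  also have "\<dots> \<le> r"
    unfolding r_def using assms q_ge_2 by (intro powr_mono) auto
  finally have "r \<ge> 4" .
  have term_le: "amp k * (sin (freq k * step n / 2))\<^sup>2 \<le> r ^ Suc k * ((step n)\<^sup>2 / 4)" for k
  proof -
    have "amp k * (sin (freq k * step n / 2))\<^sup>2 \<le> amp k * (freq k * step n / 2)\<^sup>2"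
      using amp_pos[of k] by (intro mult_left_mono sin_squared_le) auto
    also have "\<dots> = real q powr (real (Suc k) * (s - 1)) * freq k * ((step n)\<^sup>2 / 4)"
      using freq_pos[of k] by (simp add: amp_def power2_eq_square)
    also have "\<dots> \<le> real q powr (real (Suc k) * (s - 1)) * real q ^ (2 * Suc k) * ((step n)\<^sup>2 / 4)"
      by (intro mult_right_mono mult_left_mono freq_bounds) auto
    also have "real q powr (real (Suc k) * (s - 1)) * real q ^ (2 * Suc k) = r ^ Suc k"
      unfolding q_power_eq_powr r powr_add[symmetric] by (simp add: algebra_simps)
    finally show ?thesis .
  qed
  have "(\<Sum>k<n. amp k * (sin (freq k * step n / 2))\<^sup>2) \<le> (\<Sum>k<n. r ^ Suc k * ((step n)\<^sup>2 / 4))"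
    by (intro sum_mono term_le)
  also have "\<dots> = (\<Sum>k<n. r ^ Suc k) * ((step n)\<^sup>2 / 4)"
    by (simp add: sum_distrib_right)
  also have "\<dots> \<le> (r ^ Suc n / 3) * ((step n)\<^sup>2 / 4)"
    using \<open>r \<ge> 4\<close> by (intro mult_right_mono sum_powers_le_third) auto
  also have "\<dots> = pi\<^sup>2 / 12 * (r ^ Suc n / (real q ^ (2 * Suc n))\<^sup>2)"
    by (simp add: step_def power_divide)
  also have "r ^ Suc n / (real q ^ (2 * Suc n))\<^sup>2 = real q powr (real (Suc n) * (s - 3))"
    unfolding q_power_eq_powr r power2_eq_square powr_add[symmetric] powr_diff[symmetric]
    by (simp add: algebra_simps)
  finally show ?thesis .
qed

text \<open>Split the series at index \<open>n\<close>. The term \<open>n\<close> itself contributes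
  almost its full amplitude, the terms below it at most \<open>pi\<^sup>2 / 12\<close> times the
  reference size, and those above it carry the small factor
  \<open>(sin (step n / 2))\<^sup>2\<close>. The factor 4 of the second difference gives the stated
  constants.\<close>

lemma second_difference_ge:
  assumes "s > 1" "\<bar>sin (freq n * t)\<bar> = 1"
  shows "\<bar>vel (t + step n) - 2 * vel t + vel (t - step n)\<bar>
     \<ge> (4 - pi\<^sup>2 / 3) * real q powr (real (Suc n) * (s - 3)) - (\<Sum>k. amp k) * (step n)\<^sup>2"
proof -
  define \<beta> where "\<beta> = real q powr (real (Suc n) * (s - 3))"
  define h where "h = step n"
  define c where "c k = (sin (freq k * h / 2))\<^sup>2" for k
  define T where "T k = amp k * (c k * sin (freq k * t))" for k
  have c: "0 \<le> c k" "c k \<le> 1" for k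
    by (auto simp: c_def abs_square_le_1)
  have T_le: "\<bar>T k\<bar> \<le> amp k * c k" for k
  proof -
    have "\<bar>T k\<bar> = amp k * c k * \<bar>sin (freq k * t)\<bar>"
      using amp_pos[of k] c[of k] by (simp add: T_def abs_mult)
    also have "\<dots> \<le> amp k * c k * 1"
      using amp_pos[of k] c[of k] by (intro mult_left_mono) auto
    finally show ?thesis by simp
  qed
  have T_sum: "summable T"
    unfolding T_def
  proof (rule summable_amp_mult)
    show "\<bar>c k * sin (freq k * t)\<bar> \<le> 1" for k
      unfolding abs_mult using c[of k] by (intro mult_le_one) auto
  qed
  have split: "suminf T = (\<Sum>k. T (k + Suc n)) + ((\<Sum>k<n. T k) + T n)"
    using suminf_split_initial_segment[OF T_sum, of "Suc n"] by simp
  have low: "\<bar>\<Sum>k<n. T k\<bar> \<le> pi\<^sup>2 / 12 * \<beta>"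
  proof -
    have "\<bar>\<Sum>k<n. T k\<bar> \<le> (\<Sum>k<n. \<bar>T k\<bar>)"
      by (rule sum_abs)
    also have "\<dots> \<le> (\<Sum>k<n. amp k * c k)"
      by (intro sum_mono T_le)
    also have "\<dots> \<le> pi\<^sup>2 / 12 * \<beta>"
      using low_freq_sum_le[OF assms(1)] by (simp add: c_def h_def \<beta>_def)
    finally show ?thesis .
  qed
  have high: "\<bar>\<Sum>k. T (k + Suc n)\<bar> \<le> (\<Sum>k. amp (k + Suc n)) * (h\<^sup>2 / 4)"
  proof -
    have "\<bar>T (k + Suc n)\<bar> \<le> amp (k + Suc n) * (h\<^sup>2 / 4)" for k
    proof -
      have "c (k + Suc n) = (sin (h / 2))\<^sup>2"
        unfolding c_def h_def by (intro sin_high_freq) auto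
      also have "\<dots> \<le> (h / 2)\<^sup>2"
        by (rule sin_squared_le)
      finally have "amp (k + Suc n) * c (k + Suc n) \<le> amp (k + Suc n) * (h\<^sup>2 / 4)"
        using amp_pos[of "k + Suc n"] by (intro mult_left_mono) (auto simp: power_divide)
      then show ?thesis
        using T_le[of "k + Suc n"] by linarith
    qed
    then have "norm (\<Sum>k. T (k + Suc n)) \<le> (\<Sum>k. amp (k + Suc n) * (h\<^sup>2 / 4))"
      by (intro norm_suminf_le summable_mult2 summable_ignore_initial_segment summable_amp) auto
    also have "\<dots> = (\<Sum>k. amp (k + Suc n)) * (h\<^sup>2 / 4)"
      by (intro suminf_mult2[symmetric] summable_ignore_initial_segment summable_amp)
    finally show ?thesis by simp
  qed
  have own: "\<bar>T n\<bar> \<ge> \<beta> - amp n * (h\<^sup>2 / 4)"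
  proof -
    have "\<bar>T n\<bar> = amp n * c n"
      using amp_pos[of n] c[of n] assms(2) by (simp add: T_def abs_mult)
    also have "c n = 1 - (sin (h / 2))\<^sup>2"
      unfolding c_def h_def sin_own_freq by (simp add: cos_squared_eq)
    also have "amp n * \<dots> = amp n - amp n * (sin (h / 2))\<^sup>2"
      by (simp add: algebra_simps)
    finally have "\<bar>T n\<bar> = amp n - amp n * (sin (h / 2))\<^sup>2" .
    moreover have "amp n * (sin (h / 2))\<^sup>2 \<le> amp n * (h / 2)\<^sup>2"
      using amp_pos[of n] by (intro mult_left_mono sin_squared_le) auto
    ultimately show ?thesis
      using amp_ge[of n] by (simp add: \<beta>_def power_divide)
  qed
  \<comment> \<open>The error of the own term and the error of the tail are both multiples of
    \<open>h\<^sup>2 / 4\<close>, so together they cost at most the total amplitude.\<close>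
  have "(\<Sum>k. amp (k + Suc n)) + amp n \<le> suminf amp"
    using suminf_split_initial_segment[OF summable_amp, of "Suc n"] sum_nonneg[of "{..<n}" amp] amp_pos
    by (simp add: less_imp_le)
  then have "((\<Sum>k. amp (k + Suc n)) + amp n) * (h\<^sup>2 / 4) \<le> suminf amp * (h\<^sup>2 / 4)"
    by (intro mult_right_mono) auto
  moreover have "\<bar>suminf T\<bar> \<ge> \<bar>T n\<bar> - \<bar>\<Sum>k<n. T k\<bar> - \<bar>\<Sum>k. T (k + Suc n)\<bar>"
    unfolding split by linarith
  ultimately have "\<bar>suminf T\<bar> \<ge> \<beta> - pi\<^sup>2 / 12 * \<beta> - suminf amp * (h\<^sup>2 / 4)"
    using low high own by (simp add: distrib_right)
  moreover have "\<bar>vel (t + h) - 2 * vel t + vel (t - h)\<bar> = 4 * \<bar>suminf T\<bar>"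
    unfolding vel_second_difference T_def c_def by simp
  ultimately show ?thesis
    unfolding h_def \<beta>_def by (simp add: algebra_simps)
qed

text \<open>The squared step decays like \<open>real q powr (- 4 * real n)\<close>, faster than the
  amplitude; their ratio decays geometrically with ratio \<open>real q powr (- s - 1)\<close>. The
  constant 1/10 fits into the margin of 7/10 and still leaves more than 1/2.\<close>

lemma eventually_step_small:
  "eventually (\<lambda>n. (\<Sum>k. amp k) * (step n)\<^sup>2 \<le> real q powr (real (Suc n) * (s - 3)) / 10) sequentially"
proof -
  define r where "r = real q powr (- s - 1)"
  have r: "0 < r" "r < 1"
    using q_ge_2 s_pos unfolding r_def by (auto intro!: powr_less_one)
  have "(\<lambda>n. suminf amp * pi\<^sup>2 * r ^ Suc n) \<longlonglongrightarrow> suminf amp * pi\<^sup>2 * 0"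
    using r by (intro tendsto_mult tendsto_const LIMSEQ_Suc LIMSEQ_power_zero) auto
  then have "eventually (\<lambda>n. suminf amp * pi\<^sup>2 * r ^ Suc n < 1 / 10) sequentially"
    by (rule order_tendstoD) auto
  then show ?thesis
  proof eventually_elim
    case (elim n)
    define \<beta> where "\<beta> = real q powr (real (Suc n) * (s - 3))"
    have "r ^ Suc n = real q powr (real (Suc n) * (- s - 1))"
      using q_ge_2 unfolding r_def by (simp add: powr_powr powr_realpow[symmetric] mult.commute del: power_Suc)
    then have "r ^ Suc n * \<beta> = 1 / (real q ^ (2 * Suc n))\<^sup>2"
      unfolding q_power_eq_powr power2_eq_square powr_add[symmetric] powr_minus_divide[symmetric] \<beta>_def
      by (simp only: powr_add[symmetric]) (simp add: algebra_simps)
    then have "suminf amp * (step n)\<^sup>2 = suminf amp * pi\<^sup>2 * (r ^ Suc n * \<beta>)"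
      by (simp add: step_def power_divide del: power_Suc)
    also have "\<dots> = suminf amp * pi\<^sup>2 * r ^ Suc n * \<beta>"
      by (simp only: mult.assoc)
    also have "\<dots> \<le> 1 / 10 * \<beta>"
      using elim by (intro mult_right_mono) (auto simp: \<beta>_def)
    finally show ?case
      by (simp add: \<beta>_def)
  qed
qed

text \<open>A point where the sine of frequency \<open>freq n\<close> is extremal lies within
  \<open>4 / 3 * step n\<close> to the right of \<open>x + step n\<close>. With one further step on
  its right this stays inside a window of length \<open>4 * step n\<close>.\<close>

lemma eventually_vel_oscillation_level:
  assumes "s > 1"
  shows "eventually (\<lambda>n. \<forall>x. \<exists>u\<in>{x..<x + 4 * step n}. \<exists>v\<in>{x..<x + 4 * step n}.
      \<bar>vel u - vel v\<bar> \<ge> real q powr (real (Suc n) * (s - 3)) / 4) sequentially"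
  using eventually_step_small
proof eventually_elim
  case (elim n)
  define \<beta> where "\<beta> = real q powr (real (Suc n) * (s - 3))"
  have "\<beta> > 0"
    using q_ge_2 by (simp add: \<beta>_def)
  show ?case
  proof
    fix x
    obtain t where t: "t \<in> {x + step n..x + step n + pi / freq n}" "\<bar>sin (freq n * t)\<bar> = 1"
      using ex_abs_sin_eq_1[OF freq_pos] by blast
    have "pi / freq n \<le> pi / (3 / 4 * real q ^ (2 * Suc n))"
      using freq_bounds(1)[of n] freq_pos[of n] q_ge_2 by (intro divide_left_mono) auto
    also have "\<dots> = 4 / 3 * step n"
      by (simp add: step_def)
    finally have "pi / freq n \<le> 4 / 3 * step n" .
    moreover have "x + step n \<le> t" "t \<le> x + step n + pi / freq n"
      using t(1) by auto
    ultimately have "t + step n < x + 4 * step n" "x \<le> t - step n"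
      using step_pos[of n] by linarith+
    then have mem: "t - step n \<in> {x..<x + 4 * step n}" "t \<in> {x..<x + 4 * step n}" "t + step n \<in> {x..<x + 4 * step n}"
      using step_pos[of n] by auto
    have "(4 - pi\<^sup>2 / 3) * \<beta> \<ge> 7 / 10 * \<beta>"
      using pi_squared_third_le \<open>\<beta> > 0\<close> by (intro mult_right_mono) auto
    then have "\<bar>vel (t + step n) - 2 * vel t + vel (t - step n)\<bar> \<ge> \<beta> / 2"
      using second_difference_ge[OF assms t(2)] elim \<open>\<beta> > 0\<close> unfolding \<beta>_def[symmetric] by linarith
    \<comment> \<open>The second difference is the sum of these two differences, so one of them
      carries at least half of it.\<close>
    then have "\<bar>vel (t + step n) - vel t\<bar> \<ge> \<beta> / 4 \<or> \<bar>vel (t - step n) - vel t\<bar> \<ge> \<beta> / 4"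
      by linarith
    then show "\<exists>u\<in>{x..<x + 4 * step n}. \<exists>v\<in>{x..<x + 4 * step n}.
        \<bar>vel u - vel v\<bar> \<ge> real q powr (real (Suc n) * (s - 3)) / 4"
      using mem unfolding \<beta>_def by blast
  qed
qed

lemma step_tendsto_0: "step \<longlonglongrightarrow> 0"
proof -
  have "(\<lambda>n. pi * (1 / (real q)\<^sup>2) ^ Suc n) \<longlonglongrightarrow> pi * 0"
    using q_ge_2 by (intro tendsto_mult tendsto_const LIMSEQ_Suc LIMSEQ_power_zero) (auto simp: power_less_one_iff)
  then show ?thesis
    unfolding step_def power_mult by (simp add: power_one_over divide_inverse power_inverse del: power_Suc)
qed

text \<open>An arbitrary length \<open>d\<close> is compared with the largest window
  \<open>4 * step n\<close> that fits into it. Consecutive windows differ by the factor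
  \<open>q\<close> squared, so passing from the discrete scales to all \<open>d\<close> costs only a
  constant.\<close>

lemma vel_oscillation:
  assumes "s > 1"
  shows "\<exists>c>0. eventually (\<lambda>d. \<forall>x. \<exists>u\<in>{x..<x + d}. \<exists>v\<in>{x..<x + d}.
      \<bar>vel u - vel v\<bar> \<ge> c * d powr ((3 - s) / 2)) (at_right 0)"
proof -
  obtain n0 where n0: "\<And>n x. n \<ge> n0 \<Longrightarrow> \<exists>u\<in>{x..<x + 4 * step n}. \<exists>v\<in>{x..<x + 4 * step n}.
      \<bar>vel u - vel v\<bar> \<ge> real q powr (real (Suc n) * (s - 3)) / 4"
    using eventually_vel_oscillation_level[OF assms] unfolding eventually_sequentially by blast
  \<comment> \<open>Chosen so that the window one level above \<open>n\<close> has length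
    \<open>K / real q ^ (2 * Suc n)\<close>.\<close>
  define K where "K = 4 * pi * (real q)\<^sup>2"
  have K: "K > 0"
    using q_ge_2 by (simp add: K_def)
  have step_antimono: "step m \<ge> step n" if "m \<le> n" for m n
    unfolding step_def using q_ge_2 that by (intro divide_left_mono power_increasing) auto
  show ?thesis
  proof (intro exI conjI)
    show "1 / 4 * K powr (- ((3 - s) / 2)) > 0"
      using K by simp
    have "eventually (\<lambda>d. d \<in> {0<..<4 * step n0}) (at_right 0)"
      using step_pos[of n0] by (intro eventually_at_right_real) auto
    then show "eventually (\<lambda>d. \<forall>x. \<exists>u\<in>{x..<x + d}. \<exists>v\<in>{x..<x + d}.
      \<bar>vel u - vel v\<bar> \<ge> 1 / 4 * K powr (- ((3 - s) / 2)) * d powr ((3 - s) / 2)) (at_right 0)"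
    proof eventually_elim
      case (elim d)
      have "eventually (\<lambda>n. step n < d / 4) sequentially"
        using step_tendsto_0 by (rule order_tendstoD) (use elim in auto)
      then have "\<exists>n. 4 * step n \<le> d"
        unfolding eventually_sequentially by (metis le_refl less_eq_real_def mult.commute pos_less_divide_eq zero_less_numeral)
      define n where "n = (LEAST n. 4 * step n \<le> d)"
      have n: "4 * step n \<le> d"
        unfolding n_def by (rule LeastI_ex) fact
      \<comment> \<open>As \<open>d\<close> is shorter than the window of level \<open>n0\<close>,
        the level \<open>n\<close> is in the range of the oscillation bound and has a
        predecessor.\<close>
      have "n0 < n"
        using step_antimono[of n n0] n elim by (force simp: not_le[symmetric])
      then obtain m where m: "n = Suc m"
        using less_imp_Suc_add by blast
      have "d < 4 * step m"
        using not_less_Least[of m "\<lambda>n. 4 * step n \<le> d"] m unfolding n_def[symmetric] by simp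
      also have "4 * step m = K / real q ^ (2 * Suc n)"
        using q_ge_2 by (simp add: step_def K_def m power2_eq_square)
      finally have "d / K \<le> 1 / real q ^ (2 * Suc n)"
        using K by (simp add: field_simps)
      then have "(d / K) powr ((3 - s) / 2) \<le> (1 / real q ^ (2 * Suc n)) powr ((3 - s) / 2)"
        using s_less_2 elim K by (intro powr_mono2) auto
      also have "\<dots> = real q powr (real (Suc n) * (s - 3))"
        unfolding q_power_eq_powr powr_minus_divide[symmetric] powr_powr
        by (intro arg_cong[where f = "\<lambda>e. real q powr e"]) (simp add: field_simps)
      finally have \<beta>: "1 / 4 * K powr (- ((3 - s) / 2)) * d powr ((3 - s) / 2) \<le> real q powr (real (Suc n) * (s - 3)) / 4"
        using elim K by (simp add: powr_divide powr_minus_divide)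
      show ?case
      proof
        fix x
        have "{x..<x + 4 * step n} \<subseteq> {x..<x + d}"
          using n by auto
        moreover obtain u v where "u \<in> {x..<x + 4 * step n}" "v \<in> {x..<x + 4 * step n}"
            "\<bar>vel u - vel v\<bar> \<ge> real q powr (real (Suc n) * (s - 3)) / 4"
          using n0[of n x] \<open>n0 < n\<close> by auto
        ultimately show "\<exists>u\<in>{x..<x + d}. \<exists>v\<in>{x..<x + d}.
            \<bar>vel u - vel v\<bar> \<ge> 1 / 4 * K powr (- ((3 - s) / 2)) * d powr ((3 - s) / 2)"
          using \<beta> by (meson order_trans subsetD)
      qed
    qed
  qed
qed

lemma uniform_limit_vel: "uniform_limit UNIV (\<lambda>n t. \<Sum>k<n. amp k * sin (freq k * t)) vel sequentially"
  unfolding vel_def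
proof (rule Weierstrass_m_test[OF _ summable_amp])
  fix k t
  show "norm (amp k * sin (freq k * t)) \<le> amp k"
    using amp_pos[of k] mult_left_mono[of "\<bar>sin (freq k * t)\<bar>" 1 "amp k"] by (simp add: abs_mult)
qed

lemma continuous_vel: "continuous_on UNIV vel"
  by (rule uniform_limit_theorem[OF _ uniform_limit_vel])
     (auto intro!: always_eventually continuous_intros)

text \<open>With critical exponent \<open>(3 - s) / 2\<close> the dimension formula yields
  \<open>2 - (3 - s) / 2 = (1 + s) / 2\<close>. The positive factor \<open>C\<close> only rescales
  the Hoelder and oscillation constants.\<close>

lemma has_box_dim_vel:
  assumes "a < b" "C > 0"
  shows "has_box_dim {(t, C * vel t) | t. t \<in> {a..b}} (max ((1 + s) / 2) 1)"
proof -
  have "has_box_dim {(t, C * vel t) | t. t \<in> {a..b}} (max (2 - (3 - s) / 2) 1)"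
  proof (rule has_box_dim_graph[OF assms(1)])
    show "continuous_on {a..b} (\<lambda>t. C * vel t)"
      by (intro continuous_on_mult continuous_on_const continuous_on_subset[OF continuous_vel]) auto
    show "0 < (3 - s) / 2"
      using s_less_2 by simp
  next
    fix \<theta> :: real
    assume \<theta>: "0 < \<theta>" "\<theta> < 1" "\<theta> < (3 - s) / 2"
    show "\<exists>L. \<forall>x\<in>{a..b}. \<forall>y\<in>{a..b}. \<bar>C * vel x - C * vel y\<bar> \<le> L * \<bar>x - y\<bar> powr \<theta>"
    proof (intro exI ballI)
      fix x y
      have "\<bar>C * vel x - C * vel y\<bar> = C * \<bar>vel x - vel y\<bar>"
        using assms(2) by (simp add: right_diff_distrib[symmetric] abs_mult)
      also have "\<dots> \<le> C * (2 * (\<Sum>k. amp k * freq k powr \<theta>) * \<bar>x - y\<bar> powr \<theta>)"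
        using assms(2) vel_holder[OF \<theta>] by (intro mult_left_mono) auto
      finally show "\<bar>C * vel x - C * vel y\<bar> \<le> (C * (2 * (\<Sum>k. amp k * freq k powr \<theta>))) * \<bar>x - y\<bar> powr \<theta>"
        by (simp add: mult_ac)
    qed
  next
    assume "(3 - s) / 2 < 1"
    then have "s > 1"
      by simp
    then obtain c where c: "c > 0" "eventually (\<lambda>d. \<forall>x. \<exists>u\<in>{x..<x + d}. \<exists>v\<in>{x..<x + d}.
      \<bar>vel u - vel v\<bar> \<ge> c * d powr ((3 - s) / 2)) (at_right 0)"
      using vel_oscillation by blast
    have scale: "C * c * y \<le> \<bar>C * vel u - C * vel v\<bar>" if "\<bar>vel u - vel v\<bar> \<ge> c * y" for u v y
    proof -
      have "\<bar>C * vel u - C * vel v\<bar> = C * \<bar>vel u - vel v\<bar>"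
        using assms(2) by (simp add: right_diff_distrib[symmetric] abs_mult)
      then show ?thesis
        using mult_left_mono[OF that, of C] assms(2) by (simp add: mult_ac)
    qed
    show "\<exists>c>0. eventually (\<lambda>d. \<forall>x. {x..<x + d} \<subseteq> {a..b} \<longrightarrow>
      (\<exists>u\<in>{x..<x + d}. \<exists>v\<in>{x..<x + d}. \<bar>C * vel u - C * vel v\<bar> \<ge> c * d powr ((3 - s) / 2))) (at_right 0)"
    proof (intro exI conjI)
      show "C * c > 0"
        using assms(2) c(1) by simp
      show "eventually (\<lambda>d. \<forall>x. {x..<x + d} \<subseteq> {a..b} \<longrightarrow>
        (\<exists>u\<in>{x..<x + d}. \<exists>v\<in>{x..<x + d}. \<bar>C * vel u - C * vel v\<bar> \<ge> C * c * d powr ((3 - s) / 2))) (at_right 0)"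
        using c(2) by eventually_elim (meson scale)
    qed
  qed
  then show ?thesis
    by (simp add: field_simps)
qed

end

subsection \<open>The mean position\<close>

lemma cmod_sum_cis_squared:
  fixes c \<theta> :: "'a \<Rightarrow> real"
  shows "(cmod (\<Sum>n\<in>A. complex_of_real (c n) * exp (- \<i> * complex_of_real (\<theta> n))))\<^sup>2
    = (\<Sum>m\<in>A. \<Sum>n\<in>A. c m * c n * cos (\<theta> m - \<theta> n))"
proof -
  have "exp (- \<i> * complex_of_real y) = cis (- y)" for y
    by (simp add: cis_conv_exp)
  then have "(cmod (\<Sum>n\<in>A. complex_of_real (c n) * exp (- \<i> * complex_of_real (\<theta> n))))\<^sup>2
    = (\<Sum>n\<in>A. c n * cos (\<theta> n))\<^sup>2 + (\<Sum>n\<in>A. c n * sin (\<theta> n))\<^sup>2"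
    by (simp add: cmod_power2 sum_negf)
  also have "\<dots> = (\<Sum>m\<in>A. \<Sum>n\<in>A. c m * c n * cos (\<theta> m - \<theta> n))"
    unfolding power2_eq_square sum_product sum.distrib[symmetric]
    by (intro sum.cong refl) (simp add: cos_diff algebra_simps)
  finally show ?thesis .
qed

lemma has_integral_x_cos:
  fixes m :: int
  assumes "m \<noteq> 0"
  shows "((\<lambda>x. x * cos (of_int m * x)) has_integral (if even m then 0 else - 2 / (of_int m)\<^sup>2)) {0..pi}"
proof -
  \<comment> \<open>The antiderivative obtained by integrating by parts. At the endpoints the sine
    vanishes, so only the cosine and hence the parity of \<open>m\<close> matters.\<close>
  define F where "F x = x * sin (of_int m * x) / of_int m + cos (of_int m * x) / (of_int m)\<^sup>2" for x :: real
  have "((\<lambda>x. x * cos (of_int m * x)) has_integral (F pi - F 0)) {0..pi}"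
  proof (rule fundamental_theorem_of_calculus)
    fix x :: real
    have "(F has_real_derivative x * cos (of_int m * x)) (at x within {0..pi})"
      unfolding F_def using assms
      by (auto intro!: derivative_eq_intros simp: field_simps power2_eq_square)
    then show "(F has_vector_derivative x * cos (of_int m * x)) (at x within {0..pi})"
      by (simp add: has_real_derivative_iff_has_vector_derivative)
  qed auto
  also have "F pi - F 0 = (if even m then 0 else - 2 / (of_int m)\<^sup>2)"
  proof -
    have "sin (of_int m * pi) = 0"
      using sin_zero_iff_int2 by blast
    moreover have "cos (of_int m * pi) = (if even m then 1 else - 1)"
      by (simp add: cos_int_times_real cos_npi_int mult.commute)
    ultimately show ?thesis
      by (simp add: F_def diff_divide_distrib[symmetric])
  qed
  finally show ?thesis .
qed

text \<open>The product formula reduces the integrand to cosines of frequencies \<open>j - k\<close>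
  and \<open>j + k\<close>, which have the same parity. The odd case is half the difference of
  \<open>- 2 / m\<^sup>2\<close> at these two values of \<open>m\<close>.\<close>

definition x_sin_sin_integral :: "nat \<Rightarrow> nat \<Rightarrow> real" where
  "x_sin_sin_integral j k = (if j = k then pi\<^sup>2 / 4 else if even (j + k) then 0
     else 1 / (real j + real k)\<^sup>2 - 1 / (real j - real k)\<^sup>2)"

lemma has_integral_x_sin_sin:
  assumes "j > 0" "k > 0"
  shows "((\<lambda>x. x * (sin (real j * x) * sin (real k * x))) has_integral x_sin_sin_integral j k) {0..pi}"
proof -
  have prod: "x * (sin (real j * x) * sin (real k * x))
      = (x * cos (of_int (int j - int k) * x) - x * cos (of_int (int j + int k) * x)) / 2" for x
    by (simp add: sin_times_sin algebra_simps diff_divide_distrib)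
  have plus: "((\<lambda>x. x * cos (of_int (int j + int k) * x)) has_integral
      (if even (int j + int k) then 0 else - 2 / (of_int (int j + int k))\<^sup>2)) {0..pi}"
    using assms by (intro has_integral_x_cos) auto
  show ?thesis
  proof (cases "j = k")
    case True
    have "((\<lambda>x::real. x) has_integral (pi\<^sup>2 / 2 - 0\<^sup>2 / 2)) {0..pi}"
      using ident_has_integral[of 0 pi] by simp
    from has_integral_divide[OF has_integral_diff[OF this plus], of 2]
    show ?thesis
      unfolding prod using True by (simp add: x_sin_sin_integral_def)
  next
    case False
    have "((\<lambda>x. x * cos (of_int (int j - int k) * x)) has_integral
      (if even (int j - int k) then 0 else - 2 / (of_int (int j - int k))\<^sup>2)) {0..pi}"
      using False by (intro has_integral_x_cos) auto
    from has_integral_divide[OF has_integral_diff[OF this plus], of 2]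
    show ?thesis
      unfolding prod using False
      by (cases "even j = even k") (simp_all add: x_sin_sin_integral_def diff_divide_distrib)
  qed
qed

section \<open>The mean position as a cosine series\<close>

context box_eigenstate_sum
begin

definition coef :: "nat \<Rightarrow> real" where
  "coef n = real q powr (real n * (s - 2))"

definition partial_state :: "nat \<Rightarrow> real \<Rightarrow> real \<Rightarrow> complex" where
  "partial_state M x t = (\<Sum>n<M. complex_of_real (coef n * sin (real q ^ n * x))
     * exp (- \<i> * complex_of_real (real q ^ (2 * n) * t)))"

lemma coef_pos: "coef n > 0"
  using q_ge_2 by (simp add: coef_def)

lemma coef_eq_power: "coef n = (real q powr (s - 2)) ^ n"
  using q_ge_2 by (simp add: coef_def powr_powr powr_realpow[symmetric] mult.commute)

lemma q_powr_less_1: "real q powr (s - 2) < 1"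
  using q_ge_2 s_less_2 by (intro powr_less_one) auto

lemma summable_coef: "summable coef"
  unfolding coef_eq_power[abs_def] using q_powr_less_1 by (intro summable_geometric) auto

lemma summable_coef_squared: "summable (\<lambda>n. (coef n)\<^sup>2)"
proof (rule summable_comparison_test'[OF summable_coef])
  fix n
  have "coef n \<le> 1"
    unfolding coef_eq_power using q_powr_less_1 by (intro power_le_one) auto
  then show "norm ((coef n)\<^sup>2) \<le> coef n"
    using coef_pos[of n] by (simp add: power2_eq_square mult_left_le_one_le)
qed

lemma norm_state_term_le:
  "norm (complex_of_real (coef n * sin (real q ^ n * x)) * exp (- \<i> * complex_of_real y)) \<le> coef n"
  using coef_pos[of n] mult_left_mono[of "\<bar>sin (real q ^ n * x)\<bar>" 1 "coef n"]
  by (simp add: norm_mult abs_mult norm_exp_eq_Re)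

lemma partial_state_tendsto:
  "(\<lambda>M. complex_of_real (normc q s) * partial_state M x t) \<longlonglongrightarrow> Psi q s x t"
proof -
  have "summable (\<lambda>n. complex_of_real (coef n * sin (real q ^ n * x)) * exp (- \<i> * complex_of_real (real q ^ (2 * n) * t)))"
    by (rule summable_comparison_test'[OF summable_coef norm_state_term_le])
  then show ?thesis
    unfolding Psi_def partial_state_def coef_def by (intro tendsto_mult tendsto_const summable_LIMSEQ)
qed

lemma norm_partial_state_le: "cmod (partial_state M x t) \<le> suminf coef"
proof -
  have "cmod (partial_state M x t) \<le> (\<Sum>n<M. coef n)"
    unfolding partial_state_def by (intro sum_norm_le norm_state_term_le)
  also have "\<dots> \<le> suminf coef"
    by (intro sum_le_suminf summable_coef) (auto intro: less_imp_le coef_pos)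
  finally show ?thesis .
qed

lemma normc_squared_pos: "(normc q s)\<^sup>2 > 0"
proof -
  have "real q powr (2 * (s - 2)) < 1"
    using q_ge_2 s_less_2 by (intro powr_less_one) auto
  then show ?thesis
    by (simp add: normc_def)
qed

lemma partial_state_integral:
  "((\<lambda>x. x * (cmod (partial_state M x t))\<^sup>2) has_integral
    (\<Sum>m<M. \<Sum>n<M. coef m * coef n * cos (real q ^ (2 * m) * t - real q ^ (2 * n) * t)
       * x_sin_sin_integral (q ^ m) (q ^ n))) {0..pi}"
proof -
  have "((\<lambda>x. \<Sum>m<M. \<Sum>n<M. coef m * coef n * cos (real q ^ (2 * m) * t - real q ^ (2 * n) * t)
      * (x * (sin (real (q ^ m) * x) * sin (real (q ^ n) * x)))) has_integral
    (\<Sum>m<M. \<Sum>n<M. coef m * coef n * cos (real q ^ (2 * m) * t - real q ^ (2 * n) * t)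
       * x_sin_sin_integral (q ^ m) (q ^ n))) {0..pi}"
    using q_ge_2 by (intro has_integral_sum has_integral_mult_right has_integral_x_sin_sin) auto
  also have "(\<lambda>x. \<Sum>m<M. \<Sum>n<M. coef m * coef n * cos (real q ^ (2 * m) * t - real q ^ (2 * n) * t)
      * (x * (sin (real (q ^ m) * x) * sin (real (q ^ n) * x))))
     = (\<lambda>x. x * (cmod (partial_state M x t))\<^sup>2)"
    unfolding partial_state_def cmod_sum_cis_squared sum_distrib_left
    by (intro ext sum.cong refl) simp
  finally show ?thesis .
qed

text \<open>All \<open>q ^ n\<close> with \<open>n \<ge> 1\<close> are even, so only the diagonal and the pairs
  involving the ground state \<open>q ^ 0\<close> contribute to the mean position.\<close>

lemma x_sin_sin_integral_diag: "x_sin_sin_integral (q ^ m) (q ^ m) = pi\<^sup>2 / 4"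
  by (simp add: x_sin_sin_integral_def)

lemma x_sin_sin_integral_off_diag:
  assumes "m \<noteq> n"
  shows "x_sin_sin_integral (q ^ Suc m) (q ^ Suc n) = 0"
proof -
  have "q ^ Suc m \<noteq> q ^ Suc n"
    using assms q_ge_2 power_inject_exp[of q "Suc m" "Suc n"] by simp
  then show ?thesis
    using even_q by (simp add: x_sin_sin_integral_def)
qed

text \<open>For even \<open>q\<close> the sum \<open>q ^ Suc k + 1\<close> is odd, so the integral
  does not vanish. With \<open>y = real q ^ Suc k\<close> the two fractions combine over the squared
  product of \<open>y + 1\<close> and \<open>y - 1\<close>, which is \<open>freq k\<close>
  squared.\<close>

lemma x_sin_sin_integral_ground:
  "x_sin_sin_integral (q ^ Suc k) (q ^ 0) = - 4 * real q ^ Suc k / (freq k)\<^sup>2"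
  "x_sin_sin_integral (q ^ 0) (q ^ Suc k) = - 4 * real q ^ Suc k / (freq k)\<^sup>2"
proof -
  define y where "y = real q ^ Suc k"
  have "2 \<le> q ^ Suc k"
    using q_ge_2 self_le_power[of q "Suc k"] by linarith
  then have ne: "q ^ Suc k \<noteq> 1" and y: "y \<ge> 2"
    unfolding y_def by (linarith, metis of_nat_le_iff of_nat_numeral of_nat_power)
  have odd: "odd (q ^ Suc k + 1)"
    using even_q by simp
  have freq: "freq k = (y + 1) * (y - 1)"
  proof -
    have "real q ^ (2 * Suc k) = y * y"
      unfolding y_def power_add[symmetric] mult_2 ..
    then show ?thesis
      by (simp add: freq_def algebra_simps)
  qed
  have "1 / (y + 1)\<^sup>2 - 1 / (y - 1)\<^sup>2 = ((y - 1)\<^sup>2 - (y + 1)\<^sup>2) / ((y + 1)\<^sup>2 * (y - 1)\<^sup>2)"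
    using y by (simp add: diff_divide_eq_iff divide_diff_eq_iff)
  also have "\<dots> = - 4 * y / (freq k)\<^sup>2"
    unfolding freq power_mult_distrib by (simp add: power2_eq_square algebra_simps)
  finally have *: "1 / (y + 1)\<^sup>2 - 1 / (y - 1)\<^sup>2 = - 4 * y / (freq k)\<^sup>2" .
  show "x_sin_sin_integral (q ^ Suc k) (q ^ 0) = - 4 * real q ^ Suc k / (freq k)\<^sup>2"
    using * ne odd unfolding x_sin_sin_integral_def y_def by simp
  show "x_sin_sin_integral (q ^ 0) (q ^ Suc k) = - 4 * real q ^ Suc k / (freq k)\<^sup>2"
    using * ne odd unfolding x_sin_sin_integral_def y_def
    by (simp add: power2_commute[of 1] add.commute[of 1])
qed

text \<open>Matches the position coefficient with \<open>amp k / freq k\<close>, so that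
  differentiating the cosine in time produces exactly \<open>amp k\<close>.\<close>

lemma coef_amp: "coef (Suc k) * (real q ^ Suc k / (freq k)\<^sup>2) = amp k / freq k"
proof -
  have "coef (Suc k) * real q ^ Suc k = real q powr (real (Suc k) * (s - 1))"
    using q_ge_2 unfolding coef_def
    by (subst powr_realpow[symmetric]) (auto simp: powr_add[symmetric] algebra_simps)
  then show ?thesis
    by (simp add: amp_def power2_eq_square field_simps)
qed

text \<open>Splitting index 0 off both sums leaves the diagonal, which is constant in time, and two
  equal families of pairs with the ground state. Each family carries the factor 4, hence the
  8.\<close>

lemma partial_double_sum:
  "(\<Sum>m<Suc K. \<Sum>n<Suc K. coef m * coef n * cos (real q ^ (2 * m) * t - real q ^ (2 * n) * t)
       * x_sin_sin_integral (q ^ m) (q ^ n))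
   = pi\<^sup>2 / 4 * (\<Sum>m<Suc K. (coef m)\<^sup>2) - 8 * (\<Sum>k<K. amp k / freq k * cos (freq k * t))"
proof -
  define f where "f m n = coef m * coef n * cos (real q ^ (2 * m) * t - real q ^ (2 * n) * t)
       * x_sin_sin_integral (q ^ m) (q ^ n)" for m n
  have diag: "f m m = pi\<^sup>2 / 4 * (coef m)\<^sup>2" for m
    unfolding f_def x_sin_sin_integral_diag by (simp add: power2_eq_square)
  have coef0: "coef 0 = 1"
    using q_ge_2 by (simp add: coef_def)
  have f_right: "f (Suc k) 0 = - 4 * (amp k / freq k * cos (freq k * t))" for k
  proof -
    have "real q ^ (2 * Suc k) * t - real q ^ (2 * 0) * t = freq k * t"
      by (simp add: freq_def left_diff_distrib)
    then have "f (Suc k) 0 = - 4 * (coef (Suc k) * (real q ^ Suc k / (freq k)\<^sup>2) * cos (freq k * t))"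
      unfolding f_def x_sin_sin_integral_ground coef0 by simp
    then show ?thesis
      unfolding coef_amp .
  qed
  have f_left: "f 0 (Suc k) = - 4 * (amp k / freq k * cos (freq k * t))" for k
  proof -
    have "real q ^ (2 * 0) * t - real q ^ (2 * Suc k) * t = - (freq k * t)"
      by (simp add: freq_def left_diff_distrib)
    then have "f 0 (Suc k) = - 4 * (coef (Suc k) * (real q ^ Suc k / (freq k)\<^sup>2) * cos (freq k * t))"
      unfolding f_def x_sin_sin_integral_ground coef0 by simp
    then show ?thesis
      unfolding coef_amp .
  qed
  have inner: "(\<Sum>n<K. f (Suc m) (Suc n)) = f (Suc m) (Suc m)" if "m < K" for m
  proof -
    have "(\<Sum>n<K. f (Suc m) (Suc n)) = (\<Sum>n<K. if n = m then f (Suc m) (Suc m) else 0)"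
      by (intro sum.cong refl) (auto simp: f_def x_sin_sin_integral_off_diag simp del: power_Suc)
    then show ?thesis
      using that by simp
  qed
  have "(\<Sum>m<Suc K. \<Sum>n<Suc K. f m n)
      = f 0 0 + (\<Sum>n<K. f 0 (Suc n)) + ((\<Sum>m<K. f (Suc m) 0) + (\<Sum>m<K. \<Sum>n<K. f (Suc m) (Suc n)))"
    by (simp only: sum.lessThan_Suc_shift sum.distrib)
  also have "(\<Sum>m<K. \<Sum>n<K. f (Suc m) (Suc n)) = (\<Sum>m<K. f (Suc m) (Suc m))"
    by (intro sum.cong refl inner) auto
  also have "f 0 0 + (\<Sum>n<K. f 0 (Suc n)) + ((\<Sum>m<K. f (Suc m) 0) + (\<Sum>m<K. f (Suc m) (Suc m)))
     = (\<Sum>m<Suc K. f m m) + (\<Sum>n<K. f 0 (Suc n)) + (\<Sum>m<K. f (Suc m) 0)"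
    by (simp only: sum.lessThan_Suc_shift ac_simps)
  also have "\<dots> = pi\<^sup>2 / 4 * (\<Sum>m<Suc K. (coef m)\<^sup>2) - 8 * (\<Sum>k<K. amp k / freq k * cos (freq k * t))"
    unfolding diag f_left f_right sum_distrib_left[symmetric] by simp
  finally show ?thesis
    unfolding f_def .
qed

lemma summable_amp_div_freq: "summable (\<lambda>k. amp k / freq k * cos (freq k * t))"
proof -
  have "summable (\<lambda>k. amp k * (cos (freq k * t) / freq k))"
  proof (rule summable_amp_mult)
    fix k
    have "\<bar>cos (freq k * t) / freq k\<bar> \<le> 1 / 1"
      unfolding abs_divide using freq_bounds(3)[of k] by (intro frac_le) auto
    then show "\<bar>cos (freq k * t) / freq k\<bar> \<le> 1"
      by simp
  qed
  then show ?thesis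
    by simp
qed

text \<open>The truncated states are bounded uniformly by the sum of all \<open>coef n\<close>, so
  dominated convergence carries the formula for finite sums over to the limit.\<close>

lemma avgpos_eq:
  "avgpos q s t = (normc q s)\<^sup>2 * (pi\<^sup>2 / 4 * (\<Sum>n. (coef n)\<^sup>2) - 8 * (\<Sum>k. amp k / freq k * cos (freq k * t)))"
proof -
  define f where "f M x = x * (cmod (complex_of_real (normc q s) * partial_state M x t))\<^sup>2" for M x
  define V where "V M = (normc q s)\<^sup>2 * (\<Sum>m<M. \<Sum>n<M. coef m * coef n
     * cos (real q ^ (2 * m) * t - real q ^ (2 * n) * t) * x_sin_sin_integral (q ^ m) (q ^ n))" for M
  have f_alt: "f M = (\<lambda>x. (normc q s)\<^sup>2 * (x * (cmod (partial_state M x t))\<^sup>2))" for M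
    unfolding f_def by (simp add: norm_mult power_mult_distrib mult_ac)
  have f_int: "(f M has_integral V M) {0..pi}" for M
    unfolding f_alt V_def by (intro has_integral_mult_right partial_state_integral)
  have "(\<lambda>M. integral {0..pi} (f M)) \<longlonglongrightarrow> integral {0..pi} (\<lambda>x. x * Pdens q s x t)"
  proof (rule dominated_convergence(2))
    show "f M integrable_on {0..pi}" for M
      using f_int[of M] by (rule has_integral_integrable)
    show "(\<lambda>x. (normc q s)\<^sup>2 * (pi * (suminf coef)\<^sup>2)) integrable_on {0..pi}"
      by (rule integrable_const_ivl)
    show "norm (f M x) \<le> (normc q s)\<^sup>2 * (pi * (suminf coef)\<^sup>2)" if "x \<in> {0..pi}" for M x
    proof -
      have "norm (f M x) = (normc q s)\<^sup>2 * (x * (cmod (partial_state M x t))\<^sup>2)"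
        using that by (simp add: f_alt abs_mult)
      also have "\<dots> \<le> (normc q s)\<^sup>2 * (pi * (suminf coef)\<^sup>2)"
        using that by (intro mult_left_mono mult_mono power_mono norm_partial_state_le) auto
      finally show ?thesis .
    qed
    show "(\<lambda>M. f M x) \<longlonglongrightarrow> x * Pdens q s x t" for x
      unfolding f_def Pdens_def
      by (intro tendsto_mult tendsto_const tendsto_power tendsto_norm partial_state_tendsto)
  qed
  moreover have "integral {0..pi} (f M) = V M" for M
    using f_int by (rule integral_unique)
  ultimately have "V \<longlonglongrightarrow> avgpos q s t"
    by (simp add: avgpos_def)
  \<comment> \<open>The closed form of the double sum needs the ground state to be present, so the
    limit is taken along \<open>Suc K\<close>.\<close>
  then have "(\<lambda>K. V (Suc K)) \<longlonglongrightarrow> avgpos q s t"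
    by (rule LIMSEQ_Suc)
  moreover have "(\<lambda>K. V (Suc K)) \<longlonglongrightarrow>
    (normc q s)\<^sup>2 * (pi\<^sup>2 / 4 * (\<Sum>n. (coef n)\<^sup>2) - 8 * (\<Sum>k. amp k / freq k * cos (freq k * t)))"
    unfolding V_def partial_double_sum
    by (intro tendsto_mult tendsto_diff tendsto_const LIMSEQ_Suc summable_LIMSEQ
        summable_coef_squared summable_amp_div_freq)
  ultimately show ?thesis
    by (rule LIMSEQ_unique)
qed

section \<open>Termwise differentiation and the velocity\<close>

lemma avgpos_has_derivative:
  "(avgpos q s has_real_derivative 8 * (normc q s)\<^sup>2 * vel t) (at t)"
proof -
  have "((\<lambda>t. \<Sum>k. amp k / freq k * cos (freq k * t)) has_real_derivative (\<Sum>k. - (amp k * sin (freq k * t)))) (at t)"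
  proof (rule has_field_derivative_series'(2))
    show "((\<lambda>t. amp k / freq k * cos (freq k * t)) has_real_derivative - (amp k * sin (freq k * t))) (at t within UNIV)"
      for k t
      using freq_pos[of k] by (auto intro!: derivative_eq_intros)
    \<comment> \<open>The differentiated series is the negated velocity series, whose uniform
      convergence justifies differentiating term by term.\<close>
    have "uniform_limit UNIV (\<lambda>n t. - (\<Sum>k<n. amp k * sin (freq k * t))) (\<lambda>t. - vel t) sequentially"
      by (intro uniform_limit_uminus uniform_limit_vel)
    then show "uniformly_convergent_on UNIV (\<lambda>n t. \<Sum>k<n. - (amp k * sin (freq k * t)))"
      unfolding uniformly_convergent_on_def sum_negf by blast
    show "summable (\<lambda>k. amp k / freq k * cos (freq k * 0))"
      by (rule summable_amp_div_freq)
  qed auto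
  also have "(\<Sum>k. - (amp k * sin (freq k * t))) = - vel t"
    unfolding vel_def by (intro suminf_minus summable_vel)
  finally have deriv: "((\<lambda>t. \<Sum>k. amp k / freq k * cos (freq k * t)) has_real_derivative - vel t) (at t)" .
  show ?thesis
    unfolding avgpos_eq[abs_def] by (rule derivative_eq_intros deriv refl | simp)+
qed

lemma avgvel_eq: "avgvel q s = (\<lambda>t. 8 * (normc q s)\<^sup>2 * vel t)"
  unfolding avgvel_def using DERIV_imp_deriv[OF avgpos_has_derivative] by (intro ext)

end

theorem theorem1:
  fixes q :: nat and s a b :: real
  assumes "even q" and "q \<ge> 2" and "0 < s" and "s < 2" and "a < b"
  shows "(\<forall>t. avgpos q s differentiable (at t))
         \<and> continuous_on UNIV (avgvel q s)
         \<and> has_box_dim {(t, avgvel q s t) | t. t \<in> {a..b}} (max ((1 + s) / 2) 1)"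
proof -
  interpret box_eigenstate_sum q s
    using assms by unfold_locales
  have "avgpos q s differentiable (at t)" for t
    using avgpos_has_derivative[of t] real_differentiable_def by blast
  moreover have "continuous_on UNIV (avgvel q s)"
    unfolding avgvel_eq by (intro continuous_on_mult continuous_on_const continuous_vel)
  moreover have "has_box_dim {(t, avgvel q s t) | t. t \<in> {a..b}} (max ((1 + s) / 2) 1)"
    unfolding avgvel_eq using \<open>a < b\<close> normc_squared_pos by (intro has_box_dim_vel) auto
  ultimately show ?thesis
    by blast
qed

end
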